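(* Let $\mathbf{A}\in\mathbb{R}^{n\times m}$, $\mathbf{y}\in\mathbb{N}^n$, $\bm{\mu}_0\in\mathbb{R}^m$ and $\mathbf{C}_0\in\mathcal{S}_m^+$, and for $(\mathbf{\bar x},\mathbf{C})\in\mathbb{R}^m\times\mathcal{S}_m^+$ let $$F(\mathbf{\bar{x}},\mathbf{C}) = (\mathbf{y},\mathbf{A}\mathbf{\bar{x}})- (\mathbf{1}_n,e^{\mathbf{A}\mathbf{\bar{x}}+\frac{1}{2}\mathrm{diag}(\mathbf{A}\mathbf{C}\mathbf{A}^t)}) - \tfrac{1}{2}(\mathbf{\bar{x}}-\bm{\mu}_0)^t\mathbf{C}^{-1}_0(\mathbf{\bar{x}}-\bm{\mu}_0) - \tfrac{1}{2}\mathrm{tr}(\mathbf{C}^{-1}_0\mathbf{C})+ \tfrac{1}{2}\ln|\mathbf{C}| - \tfrac{1}{2}\ln|\mathbf{C}_0| + \tfrac{m}{2} - (\mathbf{1}_n,\ln(\mathbf{y}!)).$$ Starting from $(\mathbf{\bar x}^0,\mathbf{C}^0)\in\mathbb{R}^m\times\mathcal{S}_m^+$, let the sequence $\{(\mathbf{\bar x}^k,\mathbf{C}^k)\}_{k\ge0}$ be generated by exact alternating maximization: $$\mathbf{\bar x}^{k+1}=\arg\max_{\mathbf{\bar x}\in\mathbb{R}^m}F(\mathbf{\bar x},\mathbf{C}^k),\qquad \mathbf{C}^{k+1}=\arg\max_{\mathbf{C}\in\mathcal{S}_m^+}F(\mathbf{\bar x}^{k+1},\mathbf{C}).$$ Then: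 (i) the sequence $\{F(\mathbf{\bar x}^k,\mathbf{C}^k)\}$ is monotonically increasing, i.e., $$F(\mathbf{\bar x}^0,\mathbf{C}^0) \leq F(\mathbf{\bar x}^1,\mathbf{C}^0)\leq F(\mathbf{\bar x}^1,\mathbf{C}^1)\leq \cdots \leq F(\mathbf{\bar x}^k,\mathbf{C}^k)\leq \cdots,$$ with the inequality being strict until convergence is reached; (ii) $F(\mathbf{\bar x}^k,\mathbf{C}^k)\leq \ln Z(\mathbf{y})$ for all $k$, and thus $\{F(\mathbf{\bar x}^k,\mathbf{C}^k)\}$ converges; (iii) the sequence $\{(\mathbf{\bar x}^k,\mathbf{C}^k)\}$ converges to the unique maximizer of $F$ over $\mathbb{R}^m\times\mathcal{S}_m^+$.
   Context: $\mathbb{N}=\{0,1,2,\ldots\}$. $\mathcal{S}_m^+$ is the set of real symmetric positive definite $m\times m$ matrices, $|\cdot|$ is the determinant, $\mathrm{tr}$ is the trace, the superscript $t$ denotes transpose, and $(\cdot,\cdot)$ is the Euclidean inner product. $\mathbf{1}_n\in\mathbb{R}^n$ is the all-ones vector. Exponential, logarithm and factorial of a vector are taken componentwise. For a square matrix $\mathbf{M}$, $\mathrm{diag}(\mathbf{M})$ is the vector of its diagonal entries. The maximizer of $F$, and the maximizers in each of the two alternating steps, exist and are unique. $Z(\mathbf{y})=\int_{\mathbb{R}^m} p(\mathbf{x},\mathbf{y})\,\mathrm{d}\mathbf{x}$ is the model evidence, where $$p(\mathbf{x},\mathbf{y}) = (2\pi)^{-\frac{m}{2}}|\mathbf{C}_0|^{-\frac{1}{2}}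 e^{(\mathbf{A}\mathbf{x},\mathbf{y})-(e^{\mathbf{A}\mathbf{x}},\mathbf{1}_n)-(\ln(\mathbf{y}!),\mathbf{1}_n)-\frac{1}{2}(\mathbf{x}-\bm{\mu}_0)^t\mathbf{C}^{-1}_0(\mathbf{x}-\bm{\mu}_0)}$$ is the joint density of a Poisson likelihood $y_i\sim\mathrm{Pois}(e^{(\mathbf{A}\mathbf{x})_i})$ and a Gaussian prior with mean $\bm{\mu}_0$ and covariance $\mathbf{C}_0$. The alternating maximization is the variational Gaussian approximation algorithm with exact inner updates.
   Formalization: Strictness of the very first inequality F(x^0,C^0) ≤ F(x^1,C^0) is claimed only when x^1 ≠ x^0: if x^0 already maximizes F(·,C^0), equality holds although convergence need not be reached. All other strict inequalities are kept in full. *)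

theory Defs
  imports "HOL-Analysis.Analysis"
begin

definition spd_matrices :: "(real^'m^'m) set" where
  "spd_matrices = {C. transpose C = C \<and> (\<forall>v. v \<noteq> 0 \<longrightarrow> 0 < v \<bullet> (C *v v))}"

definition vec_exp :: "real^'n \<Rightarrow> real^'n" where
  "vec_exp v = (\<chi> i. exp (v $ i))"

definition vec_ln :: "real^'n \<Rightarrow> real^'n" where
  "vec_ln v = (\<chi> i. ln (v $ i))"

definition vec_fact :: "nat^'n \<Rightarrow> real^'n" where
  "vec_fact y = (\<chi> i. fact (y $ i))"

definition vec_real :: "nat^'n \<Rightarrow> real^'n" where
  "vec_real y = (\<chi> i. real (y $ i))"

definition diag_vec :: "real^'n^'n \<Rightarrow> real^'n" where
  "diag_vec M = (\<chi> i. M $ i $ i)"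

text \<open>The constant \<^term>\<open>1 :: real^'n\<close> of the library is the all-ones vector.\<close>

definition joint_density ::
  "real^'m^'n \<Rightarrow> real^'m \<Rightarrow> real^'m^'m \<Rightarrow> real^'m \<Rightarrow> nat^'n \<Rightarrow> real" where
  "joint_density A \<mu>0 C0 x y =
     (2 * pi) powr (- (real CARD('m) / 2)) * det C0 powr (- (1/2)) *
     exp ((A *v x) \<bullet> vec_real y - vec_exp (A *v x) \<bullet> 1 - vec_ln (vec_fact y) \<bullet> 1
          - 1/2 * ((x - \<mu>0) \<bullet> (matrix_inv C0 *v (x - \<mu>0))))"

definition evidence ::
  "real^'m^'n \<Rightarrow> real^'m \<Rightarrow> real^'m^'m \<Rightarrow> nat^'n \<Rightarrow> real" where
  "evidence A \<mu>0 C0 y = (LINT x|lborel. joint_density A \<mu>0 C0 x y)"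

definition lower_bound ::
  "real^'m^'n \<Rightarrow> nat^'n \<Rightarrow> real^'m \<Rightarrow> real^'m^'m \<Rightarrow> real^'m \<Rightarrow> real^'m^'m \<Rightarrow> real" where
  "lower_bound A y \<mu>0 C0 x C =
     vec_real y \<bullet> (A *v x)
     - 1 \<bullet> vec_exp (A *v x + (1/2) *\<^sub>R diag_vec (A ** C ** transpose A))
     - 1/2 * ((x - \<mu>0) \<bullet> (matrix_inv C0 *v (x - \<mu>0)))
     - 1/2 * trace (matrix_inv C0 ** C)
     + 1/2 * ln (det C) - 1/2 * ln (det C0) + real CARD('m) / 2
     - 1 \<bullet> vec_ln (vec_fact y)"

end

(* F is strictly jointly concave: the exponential terms are convex in the affine expressions
   A x + diag(A C A^t)/2, the quadratic form is strictly concave in x and ln det is strictly concave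
   in C. Simultaneous diagonalisation C = P P^t, D = P diag(d) P^t reduces the last claim to
   ln d <= d - 1, and likewise shows that the superlevel sets of F are compact. So at a point that is
   maximal in each block separately the supergradient inequality gives global strict maximality, and
   every limit point of the iterates is such a point.
   The evidence bound is Jensen's inequality: after substituting x + L z for the integration variable,
   with C = L L^t, the joint density is the standard Gaussian density times exp h, and h has mean F(x, C). *)

theory Submission
  imports Defs "HOL-Probability.Distributions"
begin

section \<open>Diagonalisation of symmetric matrices\<close>

text \<open>For a general concave function, maximality in each block separately does not imply
  global maximality. It does here because the first-order term at \<open>(x, C)\<close> is
  \<open>mean_slope\<close> plus \<open>cov_slope\<close>, with no mixed part, and each of the two
  is a directional derivative that is nonpositive once its own block is maximal. The strictness of
  the supergradient inequality also supplies what \<open>is_arg_max\<close> leaves open: the inner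
  updates are unique, and the maximiser of F, found as a limit point, is unique as well. The
  integral in \<open>evidence\<close> defaults to 0 for a function that is not integrable, so the
  Jensen bound rests on a separate proof that the joint density is integrable, by domination with a
  Gaussian.\<close>

lemma quadratic_nonpos_imp_linear_coeff_zero:
  fixes a b :: real
  assumes "\<And>t. 2 * t * a + t\<^sup>2 * b \<le> 0"
  shows "a = 0"
proof (rule ccontr)
  assume "a \<noteq> 0"
  \<comment> \<open>Near 0 the linear term dominates, so \<open>t = a / s\<close> with
    \<open>s\<close> large gives a positive value; this \<open>s\<close> is large enough to make
    \<open>2 * s + b\<close> positive.\<close>
  define s where "s = \<bar>b\<bar> + 1"
  have s: "s > 0" "2 * s + b > 0" by (auto simp: s_def)
  have "2 * (a / s) * a + (a / s)\<^sup>2 * b = a\<^sup>2 * (2 * s + b) / s\<^sup>2"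
    using s by (simp add: field_simps power2_eq_square)
  moreover have "a\<^sup>2 * (2 * s + b) / s\<^sup>2 > 0" using s \<open>a \<noteq> 0\<close> by simp
  ultimately show False using assms[of "a / s"] by linarith
qed

text \<open>A maximiser of the Rayleigh quotient on the subspace is an eigenvector.\<close>

lemma self_adjoint_eigenvector_exists:
  fixes f :: "'a::euclidean_space \<Rightarrow> 'a"
  assumes lin: "linear f" and adj: "\<And>x y. f x \<bullet> y = x \<bullet> f y"
    and S: "subspace S" "f ` S \<subseteq> S" "S \<noteq> {0}"
  shows "\<exists>v\<in>S. norm v = 1 \<and> (\<exists>c. f v = c *\<^sub>R v)"
proof -
  let ?K = "S \<inter> sphere 0 1"
  have "compact ?K"
    using closed_subspace[OF S(1)] by (intro closed_Int_compact) auto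
  moreover have "?K \<noteq> {}"
  proof -
    obtain w where "w \<in> S" "w \<noteq> 0" using S subspace_0 by blast
    then have "inverse (norm w) *\<^sub>R w \<in> ?K" using S(1) by (auto simp: subspace_mul)
    then show ?thesis by blast
  qed
  moreover have "continuous_on ?K (\<lambda>x. x \<bullet> f x)"
    using lin by (intro continuous_intros linear_continuous_on linear_conv_bounded_linear[THEN iffD1])
  ultimately obtain v where v: "v \<in> ?K" and max: "\<And>x. x \<in> ?K \<Longrightarrow> x \<bullet> f x \<le> v \<bullet> f v"
    using continuous_attains_sup by metis
  define c where "c = v \<bullet> f v"
  have le: "x \<bullet> f x \<le> c * (x \<bullet> x)" if "x \<in> S" for x
  proof (cases "x = 0")
    case False
    let ?u = "inverse (norm x) *\<^sub>R x"
    have "?u \<in> ?K" using False that S(1) by (auto simp: subspace_mul)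
    from max[OF this] have "(inverse (norm x))\<^sup>2 * (x \<bullet> f x) \<le> c"
      by (simp add: linear_scale[OF lin] c_def power2_eq_square mult.assoc)
    then show ?thesis using False
      by (simp add: field_simps power2_norm_eq_inner)
  qed simp
  \<comment> \<open>On \<open>S\<close> the maximum of
    \<open>x \<bullet> f x - c * (x \<bullet> x)\<close> is 0, attained at \<open>v\<close>. Along
    \<open>v + t *\<^sub>R w\<close> this is a quadratic in \<open>t\<close> that is never positive,
    and its linear coefficient is twice the product of \<open>w\<close> with the residual
    \<open>f v - c *\<^sub>R v\<close>.\<close>
  have orth: "w \<bullet> (f v - c *\<^sub>R v) = 0" if "w \<in> S" for w
  proof (rule quadratic_nonpos_imp_linear_coeff_zero)
    fix t :: real
    have vS: "v \<in> S" and vv: "v \<bullet> v = 1" using v by (auto simp: norm_eq_1)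
    have "v + t *\<^sub>R w \<in> S" using vS that S(1) by (simp add: subspace_add subspace_mul)
    from le[OF this] have "(v + t *\<^sub>R w) \<bullet> f (v + t *\<^sub>R w) - c * ((v + t *\<^sub>R w) \<bullet> (v + t *\<^sub>R w)) \<le> 0"
      by simp
    also have "(v + t *\<^sub>R w) \<bullet> f (v + t *\<^sub>R w) - c * ((v + t *\<^sub>R w) \<bullet> (v + t *\<^sub>R w))
        = 2 * t * (w \<bullet> (f v - c *\<^sub>R v)) + t\<^sup>2 * (w \<bullet> f w - c * (w \<bullet> w))"
      using vv adj[of v w]
      by (simp add: linear_add[OF lin] linear_scale[OF lin] inner_simps c_def[symmetric]
          algebra_simps power2_eq_square inner_commute)
    finally show "2 * t * (w \<bullet> (f v - c *\<^sub>R v)) + t\<^sup>2 * (w \<bullet> f w - c * (w \<bullet> w)) \<le> 0" .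
  qed
  \<comment> \<open>Invariance of \<open>S\<close> contains the residual itself, so it may be tested
    against itself.\<close>
  have "f v - c *\<^sub>R v \<in> S" using v S by (auto intro!: subspace_diff subspace_mul)
  from orth[OF this] have "f v = c *\<^sub>R v" by simp
  with v show ?thesis by auto
qed

text \<open>Split off one unit eigenvector \<open>v\<close> in \<open>S\<close>. Self-adjointness
  keeps the orthogonal complement of \<open>v\<close> within \<open>S\<close> invariant, and its
  dimension is smaller; this is why the claim is made for invariant subspaces and not only for the
  whole space.\<close>

lemma self_adjoint_orthonormal_eigenbasis:
  fixes f :: "'a::euclidean_space \<Rightarrow> 'a"
  assumes lin: "linear f" and adj: "\<And>x y. f x \<bullet> y = x \<bullet> f y"
  shows "subspace S \<Longrightarrow> f ` S \<subseteq> S \<Longrightarrow>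
    \<exists>B\<subseteq>S. pairwise orthogonal B \<and> (\<forall>b\<in>B. norm b = 1 \<and> (\<exists>c. f b = c *\<^sub>R b)) \<and> span B = S"
proof (induction "dim S" arbitrary: S rule: less_induct)
  case less
  show ?case
  proof (cases "S = {0}")
    case True
    then show ?thesis by (intro exI[of _ "{}"]) auto
  next
    case False
    obtain v c where v: "v \<in> S" "norm v = 1" and c: "f v = c *\<^sub>R v"
      using self_adjoint_eigenvector_exists[OF lin adj less.prems False] by blast
    let ?T = "{x \<in> S. v \<bullet> x = 0}"
    have sT: "subspace ?T" using less.prems(1)
      by (auto simp: subspace_def inner_simps)
    have vv: "v \<bullet> v = 1" using v by (simp add: norm_eq_1)
    have "f ` ?T \<subseteq> ?T" using less.prems(2) adj[of v] c by (auto simp: image_subset_iff) (metis inner_scaleR_left mult_zero_right)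
    moreover have "dim ?T < dim S"
    proof (rule dim_psubset)
      have "v \<notin> ?T" using vv by simp
      then have "?T \<subset> S" using v(1) by blast
      then show "span ?T \<subset> span S"
        using less.prems(1) sT by (metis span_eq_iff)
    qed
    ultimately obtain B where B: "B \<subseteq> ?T" "pairwise orthogonal B"
        "\<forall>b\<in>B. norm b = 1 \<and> (\<exists>c. f b = c *\<^sub>R b)" "span B = ?T"
      using less.hyps[OF _ sT] by blast
    have "span (insert v B) = S"
    proof
      show "span (insert v B) \<subseteq> S"
        using B(1) v(1) less.prems(1) by (intro span_minimal) auto
      show "S \<subseteq> span (insert v B)"
      proof
        fix x assume "x \<in> S"
        then have "x - (v \<bullet> x) *\<^sub>R v \<in> ?T"
          using less.prems(1) v(1) vv by (auto simp: subspace_diff subspace_mul inner_simps)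
        then have "x - (v \<bullet> x) *\<^sub>R v \<in> span B" by (simp add: B(4))
        then show "x \<in> span (insert v B)" by (auto simp: span_insert)
      qed
    qed
    moreover have "pairwise orthogonal (insert v B)"
      using B(1,2) by (auto simp: pairwise_insert orthogonal_def inner_commute)
    ultimately show ?thesis
      using B(1,3) v c by (intro exI[of _ "insert v B"]) auto
  qed
qed

section \<open>Matrix form of the spectral theorem and simultaneous diagonalisation\<close>

definition diag_mat :: "('m \<Rightarrow> real) \<Rightarrow> real^'m^'m" where
  "diag_mat d = (\<chi> i j. if i = j then d i else 0)"

lemma symmetric_matrix_inner:
  assumes "transpose S = S"
  shows "(S *v x) \<bullet> y = x \<bullet> (S *v (y::real^'m))"
  by (metis assms dot_lmul_matrix transpose_matrix_vector)

text \<open>An orthonormal eigenbasis has as many elements as the index type, so it can be numbered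
  by that type and used as the columns of \<open>Q\<close>; the equation
  \<open>S ** Q = Q ** diag_mat d\<close> then says that the columns are eigenvectors.\<close>

theorem symmetric_matrix_diagonalizable:
  fixes S :: "real^'m^'m"
  assumes "transpose S = S"
  shows "\<exists>Q d. orthogonal_matrix Q \<and> S = Q ** diag_mat d ** transpose Q"
proof -
  note adj = symmetric_matrix_inner[OF assms]
  obtain B where B: "pairwise orthogonal B" "\<forall>b\<in>B. norm b = 1 \<and> (\<exists>c. S *v b = c *\<^sub>R b)"
      "span B = (UNIV :: (real^'m) set)"
    using self_adjoint_orthonormal_eigenbasis[of "(*v) S" UNIV, OF matrix_vector_mul_linear adj] by auto
  have "independent B"
    using B(1,2) by (intro pairwise_orthogonal_independent) force+
  then have "finite B" "card B = CARD('m)"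
    using B(3) dim_eq_card[of B UNIV] by (auto simp: independent_imp_finite)
  then obtain g where g: "bij_betw g (UNIV :: 'm set) B"
    using finite_same_card_bij[of "UNIV :: 'm set" B] by auto
  obtain d where d: "\<And>b. b \<in> B \<Longrightarrow> S *v b = d b *\<^sub>R b" using B(2) by metis
  have gB: "g i \<in> B" for i using g by (auto simp: bij_betw_def)
  define Q :: "real^'m^'m" where "Q = (\<chi> i j. g j $ i)"
  have col: "column j Q = g j" for j by (simp add: column_def Q_def vec_eq_iff)
  have orth: "orthogonal_matrix Q"
    unfolding orthogonal_matrix_orthonormal_columns col
    using gB B(1,2) g by (auto simp: pairwise_def bij_betw_def inj_def) metis
  have "S ** Q = Q ** diag_mat (\<lambda>j. d (g j))"
  proof -
    have "(S ** Q) $ i $ j = (S *v g j) $ i" for i j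
      by (simp add: matrix_matrix_mult_def matrix_vector_mult_def Q_def)
    moreover have "(Q ** diag_mat (\<lambda>j. d (g j))) $ i $ j = (d (g j) *\<^sub>R g j) $ i" for i j
      by (simp add: matrix_matrix_mult_def Q_def diag_mat_def if_distrib cong: if_cong)
    ultimately show ?thesis using d[OF gB] by (simp add: vec_eq_iff)
  qed
  moreover have "S = S ** Q ** transpose Q"
    using orth by (simp add: orthogonal_matrix_def flip: matrix_mul_assoc)
  ultimately show ?thesis using orth by metis
qed

lemma inner_diag_mat: "v \<bullet> (diag_mat d *v v) = (\<Sum>i\<in>UNIV. d i * (v $ i)\<^sup>2)"
  by (simp add: inner_vec_def matrix_vector_mult_def diag_mat_def if_distrib[of "\<lambda>x. x * _"]
      power2_eq_square mult.left_commute cong: if_cong)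

lemma diag_mat_mult: "diag_mat a ** diag_mat b = diag_mat (\<lambda>i. a i * b i)"
  by (simp add: vec_eq_iff diag_mat_def matrix_matrix_mult_def if_distrib[of "\<lambda>x. x * _"] cong: if_cong)

lemma transpose_diag_mat [simp]: "transpose (diag_mat d) = diag_mat d"
  by (auto simp: vec_eq_iff diag_mat_def transpose_def)

lemma diag_mat_one: "diag_mat (\<lambda>i. 1) = mat 1"
  by (simp add: diag_mat_def mat_def)

lemma diag_mat_add: "diag_mat a + diag_mat b = diag_mat (\<lambda>i. a i + b i)"
  by (simp add: vec_eq_iff diag_mat_def)

lemma diag_mat_scaleR: "c *\<^sub>R diag_mat a = diag_mat (\<lambda>i. c * a i)"
  by (simp add: vec_eq_iff diag_mat_def)

lemma det_diag_mat: "det (diag_mat d) = (\<Prod>i\<in>UNIV. d i)"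
  by (subst det_diagonal) (auto simp: diag_mat_def)

lemma trace_diag_mat: "trace (diag_mat d) = (\<Sum>i\<in>UNIV. d i)"
  by (simp add: trace_def diag_mat_def)

lemma inner_congruence:
  "v \<bullet> ((P ** M ** transpose P) *v v) = (transpose P *v v) \<bullet> (M *v (transpose P *v (v::real^'m)))"
  by (metis dot_lmul_matrix matrix_vector_mul_assoc transpose_matrix_vector)

text \<open>Scale the columns of the eigenvector matrix by the square roots of the
  eigenvalues.\<close>

lemma spd_factorization:
  fixes C :: "real^'m^'m"
  assumes "C \<in> spd_matrices"
  shows "\<exists>L :: real^'m^'m. invertible L \<and> C = L ** transpose L"
proof -
  from assms have sym: "transpose C = C" and pos: "\<And>v. v \<noteq> 0 \<Longrightarrow> 0 < v \<bullet> (C *v v)"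
    by (auto simp: spd_matrices_def)
  obtain Q d where Q: "orthogonal_matrix Q" and C: "C = Q ** diag_mat d ** transpose Q"
    using symmetric_matrix_diagonalizable[OF sym] by blast
  have QQ: "transpose Q ** Q = mat 1" "Q ** transpose Q = mat 1" using Q by (auto simp: orthogonal_matrix_def)
  have d: "d i > 0" for i
  proof -
    \<comment> \<open>\<open>Q *v axis i 1\<close> is the i-th eigenvector; the quadratic form of
      \<open>C\<close> takes the value \<open>d i\<close> there.\<close>
    have 1: "transpose Q *v (Q *v axis i 1) = axis i 1"
      by (simp add: matrix_vector_mul_assoc QQ del: transpose_matrix_vector)
    then have "Q *v axis i 1 \<noteq> 0" by (metis axis_eq_0_iff matrix_vector_mult_0_right zero_neq_one)
    from pos[OF this] show ?thesis
      unfolding C inner_congruence 1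
      by (simp add: inner_diag_mat axis_def if_distrib[of "\<lambda>x. x ^ 2"] if_distrib[of "\<lambda>x. _ * x"] cong: if_cong)
  qed
  define L where "L = Q ** diag_mat (\<lambda>i. sqrt (d i))"
  have "C = Q ** (diag_mat (\<lambda>i. sqrt (d i)) ** diag_mat (\<lambda>i. sqrt (d i))) ** transpose Q"
    unfolding C diag_mat_mult using d by (simp add: less_imp_le)
  then have "C = L ** transpose L"
    by (simp add: L_def matrix_transpose_mul matrix_mul_assoc)
  moreover have "det L \<noteq> 0"
    using d Q det_orthogonal_matrix[of Q] by (auto simp: L_def det_mul det_diag_mat less_imp_neq[symmetric])
  ultimately show ?thesis by (auto simp: invertible_det_nz)
qed

text \<open>The factor \<open>L\<close> of \<open>C\<close> is fixed only up to an orthogonal matrix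
  on the right. This freedom is spent on diagonalising \<open>D\<close> transported by the inverse
  of \<open>L\<close>, and \<open>P = L ** Q\<close>.\<close>

theorem simultaneous_diagonalization:
  fixes C D :: "real^'m^'m"
  assumes "C \<in> spd_matrices" "transpose D = D"
  shows "\<exists>(P :: real^'m^'m) d. invertible P \<and> C = P ** transpose P \<and> D = P ** diag_mat d ** transpose P"
proof -
  obtain L :: "real^'m^'m" where L: "invertible L" "C = L ** transpose L"
    using spd_factorization[OF assms(1)] by blast
  obtain K where K: "K ** L = mat 1" "L ** K = mat 1" using L(1) by (auto simp: invertible_def)
  have Kt: "transpose K ** transpose L = mat 1"
    by (metis K(2) matrix_transpose_mul transpose_mat)
  have "transpose (K ** D ** transpose K) = K ** D ** transpose K"
    by (simp add: matrix_transpose_mul assms(2) matrix_mul_assoc)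
  then obtain Q d where Q: "orthogonal_matrix Q" and M: "K ** D ** transpose K = Q ** diag_mat d ** transpose Q"
    using symmetric_matrix_diagonalizable by blast
  have QQ: "transpose Q ** Q = mat 1" "Q ** transpose Q = mat 1" using Q by (auto simp: orthogonal_matrix_def)
  have "D = L ** (K ** D ** transpose K) ** transpose L"
    by (metis K(2) Kt matrix_mul_assoc matrix_mul_lid matrix_mul_rid)
  then have "D = (L ** Q) ** diag_mat d ** transpose (L ** Q)"
    unfolding M by (simp add: matrix_transpose_mul matrix_mul_assoc)
  moreover have "C = (L ** Q) ** transpose (L ** Q)"
    unfolding L(2) by (metis QQ(2) matrix_mul_assoc matrix_mul_rid matrix_transpose_mul)
  moreover have "invertible (L ** Q)"
    using L(1) Q invertible_mult QQ by (metis invertible_def)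
  ultimately show ?thesis by blast
qed

section \<open>Linear change of variables for Lebesgue measure\<close>

lemma prod_Basis_cart:
  fixes f :: "real^'m \<Rightarrow> 'b::comm_monoid_mult"
  shows "(\<Prod>b\<in>Basis. f b) = (\<Prod>i\<in>UNIV. f (axis i 1))"
proof -
  have "Basis = range (\<lambda>i. axis i (1::real) :: real^'m)" by (auto simp: Basis_vec_def)
  moreover have "inj (\<lambda>i::'m. axis i (1::real))" by (auto simp: inj_def axis_eq_axis)
  ultimately show ?thesis using prod.reindex[of "\<lambda>i::'m. axis i (1::real)" UNIV f] by (simp add: o_def)
qed

lemma lborel_eqI_cart:
  fixes M :: "(real^'m) measure"
  assumes "\<And>l u. (\<And>i. l $ i \<le> u $ i) \<Longrightarrow> emeasure M (box l u) = ennreal (\<Prod>i\<in>UNIV. u $ i - l $ i)"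
    and "sets M = sets borel"
  shows "lborel = M"
proof (rule lborel_eqI)
  fix l u :: "real^'m" assume "\<And>b. b \<in> Basis \<Longrightarrow> l \<bullet> b \<le> u \<bullet> b"
  then have "l $ i \<le> u $ i" for i by (simp add: cart_eq_inner_axis)
  from assms(1)[OF this] show "emeasure M (box l u) = ennreal (\<Prod>b\<in>Basis. (u - l) \<bullet> b)"
    by (simp add: prod_Basis_cart inner_axis)
qed (use assms in simp)

lemma emeasure_lborel_box_cart:
  fixes l u :: "real^'m"
  assumes "\<And>i. l $ i \<le> u $ i"
  shows "emeasure lborel (box l u) = ennreal (\<Prod>i\<in>UNIV. u $ i - l $ i)"
  using assms by (subst emeasure_lborel_box) (auto simp: prod_Basis_cart inner_axis, auto simp: Basis_vec_def inner_axis)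

interpretation lborel_product: product_sigma_finite "\<lambda>i. lborel :: real measure"
  by standard

lemma measurable_vec_lambda_PiM [measurable]:
  "(\<lambda>f. \<chi> i. f i) \<in> Pi\<^sub>M UNIV (\<lambda>i. lborel) \<rightarrow>\<^sub>M (borel :: (real^'m) measure)"
proof -
  have "(\<lambda>f. \<Sum>i\<in>UNIV. f i *\<^sub>R axis i 1) \<in> Pi\<^sub>M UNIV (\<lambda>i. lborel) \<rightarrow>\<^sub>M (borel :: (real^'m) measure)"
    by measurable
  also have "(\<lambda>f. \<Sum>i\<in>UNIV. f i *\<^sub>R axis i 1) = (\<lambda>f. (\<chi> i. f i) :: real^'m)"
    by (auto simp: vec_eq_iff axis_def if_distrib[of "\<lambda>x. _ * x"] cong: if_cong)
  finally show ?thesis .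
qed

text \<open>Gives access to Fubini one coordinate at a time and to products of one-dimensional
  integrals.\<close>

lemma lborel_cart: "lborel = distr (Pi\<^sub>M UNIV (\<lambda>i. lborel)) borel (\<lambda>f. (\<chi> i. f i) :: real^'m)"
proof (rule lborel_eqI_cart)
  fix l u :: "real^'m" assume le: "\<And>i. l $ i \<le> u $ i"
  have "(\<lambda>f. (\<chi> i. f i) :: real^'m) -` box l u \<inter> space (Pi\<^sub>M UNIV (\<lambda>i. lborel))
      = (\<Pi>\<^sub>E i\<in>UNIV. {l $ i <..< u $ i})"
    by (auto simp: mem_box_cart space_PiM PiE_def Pi_def)
  then show "emeasure (distr (Pi\<^sub>M UNIV (\<lambda>i. lborel)) borel (\<lambda>f. \<chi> i. f i)) (box l u)
      = ennreal (\<Prod>i\<in>UNIV. u $ i - l $ i)"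
    using le by (simp add: emeasure_distr lborel_product.emeasure_PiM prod_ennreal)
qed simp

text \<open>Integrate over coordinate \<open>m\<close> first: with the others fixed, the shear is a
  translation by the constant \<open>x n\<close>.\<close>

lemma nn_integral_lborel_shear:
  fixes f :: "real^'m \<Rightarrow> ennreal"
  assumes mn: "m \<noteq> n" and [measurable]: "f \<in> borel_measurable borel"
  shows "(\<integral>\<^sup>+x. f x \<partial>lborel) = (\<integral>\<^sup>+x. f (\<chi> i. if i = m then x $ m + x $ n else x $ i) \<partial>lborel)"
proof -
  let ?I = "UNIV - {m}" and ?M = "\<lambda>I. Pi\<^sub>M I (\<lambda>i. lborel :: real measure)"
  have UI: "insert m ?I = UNIV" by auto
  have lin: "linear (\<lambda>x::real^'m. (\<chi> i. if i = m then x $ m + x $ n else x $ i) :: real^'m)"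
    by (rule linearI) (auto simp: vec_eq_iff algebra_simps)
  then have [measurable]: "(\<lambda>x::real^'m. (\<chi> i. if i = m then x $ m + x $ n else x $ i) :: real^'m) \<in> borel_measurable borel"
    by (intro borel_measurable_continuous_onI linear_continuous_on) (simp add: linear_conv_bounded_linear)
  have fub: "(\<integral>\<^sup>+x. g x \<partial>lborel) = (\<integral>\<^sup>+x. (\<integral>\<^sup>+y. g (\<chi> i. (x(m := y)) i) \<partial>lborel) \<partial>?M ?I)"
    if [measurable]: "g \<in> borel_measurable borel" for g :: "real^'m \<Rightarrow> ennreal"
  proof -
    have "(\<integral>\<^sup>+x. g x \<partial>lborel) = (\<integral>\<^sup>+x. g (\<chi> i. x i) \<partial>?M (insert m ?I))"
      unfolding UI by (subst lborel_cart) (simp add: nn_integral_distr)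
    also have "\<dots> = (\<integral>\<^sup>+x. (\<integral>\<^sup>+y. g (\<chi> i. (x(m := y)) i) \<partial>lborel) \<partial>?M ?I)"
      by (rule lborel_product.product_nn_integral_insert) (simp_all add: UI)
    finally show ?thesis .
  qed
  have "(\<integral>\<^sup>+y. f (\<chi> i. (x(m := y)) i) \<partial>lborel)
      = (\<integral>\<^sup>+y. f (\<chi> i. if i = m then (\<chi> i. (x(m := y)) i) $ m + (\<chi> i. (x(m := y)) i) $ n
          else (\<chi> i. (x(m := y)) i) $ i) \<partial>lborel)"
    if "x \<in> space (?M ?I)" for x
  proof -
    have [measurable]: "(\<lambda>y. (\<chi> i. (x(m := y)) i) :: real^'m) \<in> borel_measurable borel"
    proof -
      have "(\<lambda>y. (\<chi> i. (x(m := y)) i) :: real^'m) = (\<lambda>y. (\<chi> i. (x(m := 0)) i) + y *\<^sub>R axis m 1)"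
        by (auto simp: fun_eq_iff vec_eq_iff axis_def)
      then show ?thesis by simp
    qed
    have "(\<integral>\<^sup>+y. f (\<chi> i. (x(m := y)) i) \<partial>lborel) = (\<integral>\<^sup>+y. f (\<chi> i. (x(m := x n + 1 * y)) i) \<partial>lborel)"
      by (subst nn_integral_real_affine[where c = 1 and t = "x n"]) auto
    moreover have "(\<chi> i. (x(m := x n + 1 * y)) i)
      = (\<chi> i. if i = m then (\<chi> i. (x(m := y)) i) $ m + (\<chi> i. (x(m := y)) i) $ n
          else (\<chi> i. (x(m := y)) i) $ i)" for y
      using mn by (auto simp: vec_eq_iff)
    ultimately show ?thesis by simp
  qed
  then show ?thesis
    by (subst (1 2) fub) (auto intro: nn_integral_cong simp del: vec_lambda_beta fun_upd_apply)
qed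

text \<open>The library proves this change of variables only for index types of class wellorder.\<close>

theorem nn_integral_lborel_linear:
  fixes A :: "real^'m^'m" and f :: "real^'m \<Rightarrow> ennreal"
  assumes "det A \<noteq> 0" and f: "f \<in> borel_measurable borel"
  shows "(\<integral>\<^sup>+x. f x \<partial>lborel) = ennreal \<bar>det A\<bar> * (\<integral>\<^sup>+x. f (A *v x) \<partial>lborel)"
proof -
  have meas: "(\<lambda>x. B *v x) \<in> borel_measurable borel" for B :: "real^'m^'m"
    by (intro borel_measurable_continuous_onI matrix_vector_mult_linear_continuous_on)
  \<comment> \<open>The quantifier over \<open>f\<close> belongs to the induction: for a product,
    the hypothesis for \<open>B\<close> is applied to \<open>g\<close> composed with
    \<open>A\<close>.\<close>
  have "\<forall>f\<in>borel_measurable borel. det A \<noteq> 0 \<longrightarrow>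
      (\<integral>\<^sup>+x. f x \<partial>lborel) = ennreal \<bar>det A\<bar> * (\<integral>\<^sup>+x. f (A *v x) \<partial>lborel)"
  proof (induction A rule: induct_matrix_elementary_alt)
    case (1 A B)
    have "(\<integral>\<^sup>+x. g x \<partial>lborel) = ennreal \<bar>det (A ** B)\<bar> * (\<integral>\<^sup>+x. g ((A ** B) *v x) \<partial>lborel)"
      if g: "g \<in> borel_measurable borel" and "det (A ** B) \<noteq> 0" for g
    proof -
      have dA: "det A \<noteq> 0" and dB: "det B \<noteq> 0" using that by (auto simp: det_mul)
      have "(\<integral>\<^sup>+x. g x \<partial>lborel) = ennreal \<bar>det A\<bar> * (\<integral>\<^sup>+x. g (A *v x) \<partial>lborel)"
        using 1(1) g dA by blast
      also have "(\<integral>\<^sup>+x. g (A *v x) \<partial>lborel) = ennreal \<bar>det B\<bar> * (\<integral>\<^sup>+x. g (A *v (B *v x)) \<partial>lborel)"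
        using 1(2)[THEN bspec, of "\<lambda>x. g (A *v x)"] measurable_compose[OF meas g] dB by blast
      finally show ?thesis
        by (simp add: det_mul abs_mult ennreal_mult mult.assoc matrix_vector_mul_assoc)
    qed
    then show ?case by blast
  next
    case (2 A i)
    then show ?case using det_zero_row(1)[of i A] by auto
  next
    case (3 A)
    have det: "det A = (\<Prod>i\<in>UNIV. A $ i $ i)" using 3 by (rule det_diagonal)
    have "(\<integral>\<^sup>+x. g x \<partial>lborel) = ennreal \<bar>det A\<bar> * (\<integral>\<^sup>+x. g (A *v x) \<partial>lborel)"
      if g: "g \<in> borel_measurable borel" and "det A \<noteq> 0" for g
    proof -
      have nz: "A $ i $ i \<noteq> 0" for i using \<open>det A \<noteq> 0\<close> by (simp add: det)
      \<comment> \<open>The scaling theorem wants factors indexed by \<open>Basis\<close>; at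
        \<open>axis i 1\<close> the quadratic form of a diagonal matrix returns its i-th
        entry.\<close>
      define c :: "real^'m \<Rightarrow> real" where "c j = j \<bullet> (A *v j)" for j
      have c: "c (axis i 1) = A $ i $ i" for i
        by (simp add: c_def inner_axis' matrix_vector_mult_basis column_def)
      have T: "0 + (\<Sum>j\<in>Basis. (c j * (x \<bullet> j)) *\<^sub>R j) = A *v x" for x
      proof -
        have "(A *v x) \<bullet> axis i 1 = c (axis i 1) * (x \<bullet> axis i 1)" for i
          using 3[of i] by (simp add: c inner_axis matrix_vector_mult_def) (subst sum.remove[of _ i], auto intro!: sum.neutral)
        then have "(A *v x) \<bullet> j = c j * (x \<bullet> j)" if "j \<in> Basis" for j
          using that by (auto simp: Basis_vec_def)
        then show ?thesis by (subst (2) euclidean_representation[symmetric]) simp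
      qed
      have "lborel = density (distr lborel borel ((*v) A)) (\<lambda>_. ennreal \<bar>det A\<bar>)"
      proof -
        have "c j \<noteq> 0" if "j \<in> Basis" for j
          using that nz by (auto simp: Basis_vec_def c)
        from lborel_affine_euclidean[of c 0, OF this] show ?thesis
          by (simp add: T[simplified] prod_Basis_cart c det abs_prod)
      qed
      then have "(\<integral>\<^sup>+x. g x \<partial>lborel) = (\<integral>\<^sup>+x. g x \<partial>density (distr lborel borel ((*v) A)) (\<lambda>_. ennreal \<bar>det A\<bar>))"
        by (rule arg_cong[where f = "\<lambda>M. nn_integral M g"])
      also have "\<dots> = ennreal \<bar>det A\<bar> * (\<integral>\<^sup>+x. g (A *v x) \<partial>lborel)"
        using g meas[of A] by (simp add: nn_integral_density nn_integral_distr nn_integral_cmult measurable_compose[OF meas g])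
      finally show ?thesis .
    qed
    then show ?case by blast
  next
    case (4 m n)
    let ?s = "Transposition.transpose m n" and ?A = "(\<chi> i j. mat 1 $ i $ Transposition.transpose m n j) :: real^'m^'m"
    have "\<bar>det ?A\<bar> = 1"
      by (simp add: det_permute_columns permutes_swap_id sign_swap_id abs_mult)
    have Av: "?A *v x = (\<chi> i. x $ ?s i)" for x
    proof -
      have "(mat 1 $ i $ ?s j :: real) = (if j = ?s i then 1 else 0)" for i j
        by (auto simp: mat_def)
      then show ?thesis
        by (simp add: vec_eq_iff matrix_vector_mult_def if_distrib[of "\<lambda>x. x * _"] cong: if_cong)
    qed
    \<comment> \<open>Permuting coordinates maps boxes to boxes with the same side lengths.\<close>
    have "lborel = distr lborel borel ((*v) ?A)"
    proof (rule lborel_eqI_cart)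
      fix l u :: "real^'m" assume le: "\<And>i. l $ i \<le> u $ i"
      have "(*v) ?A -` box l u = box (\<chi> i. l $ ?s i) (\<chi> i. u $ ?s i)"
        by (auto simp: Av mem_box_cart) (metis transpose_involutory)+
      then have "emeasure (distr lborel borel ((*v) ?A)) (box l u) = emeasure lborel (box (\<chi> i. l $ ?s i) (\<chi> i. u $ ?s i))"
        using meas[of ?A] by (simp add: emeasure_distr)
      also have "\<dots> = ennreal (\<Prod>i\<in>UNIV. u $ ?s i - l $ ?s i)"
        using le by (subst emeasure_lborel_box_cart) auto
      also have "(\<Prod>i\<in>UNIV. u $ ?s i - l $ ?s i) = (\<Prod>i\<in>UNIV. u $ i - l $ i)"
        using prod.permute[OF permutes_swap_id, of m UNIV n "\<lambda>i. u $ i - l $ i"] by (simp add: o_def)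
      finally show "emeasure (distr lborel borel ((*v) ?A)) (box l u) = ennreal (\<Prod>i\<in>UNIV. u $ i - l $ i)" .
    qed simp
    note swap = arg_cong[OF this, where f = "\<lambda>M. nn_integral M _"]
    have "(\<integral>\<^sup>+x. g x \<partial>lborel) = (\<integral>\<^sup>+x. g (?A *v x) \<partial>lborel)"
      if "g \<in> borel_measurable borel" for g
      by (subst swap) (use that meas[of ?A] in \<open>simp add: nn_integral_distr\<close>)
    then show ?case using \<open>\<bar>det ?A\<bar> = 1\<close> by simp
  next
    case (5 m n)
    let ?A = "(\<chi> i j. of_bool (i = m \<and> j = n \<or> i = j)) :: real^'m^'m"
    \<comment> \<open>The identity with row \<open>n\<close> added to row \<open>m\<close>, a row
      operation that leaves the determinant at 1.\<close>
    have "?A = (\<chi> k. if k = m then row m (mat 1) + 1 *s row n (mat 1) else row k (mat 1))"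
      using 5 by (auto simp: vec_eq_iff row_def mat_def)
    then have "det ?A = 1"
      using det_row_operation[OF 5, of "mat 1 :: real^'m^'m" 1] by simp
    moreover have "?A *v x = (\<chi> i. if i = m then x $ m + x $ n else x $ i)" for x
    proof -
      have "(\<Sum>j\<in>UNIV. of_bool (i = m \<and> j = n \<or> i = j) * x $ j)
          = (\<Sum>j\<in>UNIV. (if j = i then x $ j else 0) + (if i = m \<and> j = n then x $ j else 0))" for i
        using 5 by (intro sum.cong) auto
      then show ?thesis
        by (simp add: vec_eq_iff matrix_vector_mult_def sum.distrib)
    qed
    ultimately show ?case using nn_integral_lborel_shear[OF 5] by simp
  qed
  then show ?thesis using assms by blast
qed

section \<open>Gaussian moments\<close>

lemma has_bochner_integral_lborel_cart_prod:
  fixes f :: "'m::finite \<Rightarrow> real \<Rightarrow> real"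
  assumes f: "\<And>i. has_bochner_integral lborel (f i) (I i)"
  shows "has_bochner_integral lborel (\<lambda>x::real^'m. \<Prod>i\<in>UNIV. f i (x $ i)) (\<Prod>i\<in>UNIV. I i)"
proof -
  have int: "integrable lborel (f i)" "integral\<^sup>L lborel (f i) = I i" for i
    using f[of i] by (auto simp: has_bochner_integral_iff)
  have [measurable]: "f i \<in> borel_measurable borel" for i using int(1)[of i] by simp
  have meas: "(\<lambda>x::real^'m. \<Prod>i\<in>UNIV. f i (x $ i)) \<in> borel_measurable borel"
    by measurable
  show ?thesis
    by (subst lborel_cart) (simp add: has_bochner_integral_iff integrable_distr_eq integral_distr meas
        lborel_product.product_integrable_prod lborel_product.product_integral_prod int)
qed

text \<open>Product form, so that integrals of factorising functions split into one-dimensional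
  ones; \<open>std_gauss_eq\<close> gives the usual expression.\<close>

definition std_gauss :: "real^'m \<Rightarrow> real" where
  "std_gauss z = (\<Prod>i\<in>UNIV. std_normal_density (z $ i))"

lemma std_gauss_eq: "std_gauss z = (2 * pi) powr (- (real CARD('m) / 2)) * exp (- (z \<bullet> z) / 2)"
  for z :: "real^'m"
proof -
  have "1 / sqrt (2 * pi) = (2 * pi) powr (- (1 / 2))"
    by (simp only: powr_minus_divide powr_half_sqrt[of "2 * pi"] pi_ge_zero mult_nonneg_nonneg zero_le_numeral)
  then have "(1 / sqrt (2 * pi)) ^ CARD('m) = ((2 * pi) powr (- (1 / 2))) powr real CARD('m)"
    using powr_realpow[of "(2 * pi) powr (- (1 / 2))" "CARD('m)"] by fastforce
  also have "\<dots> = (2 * pi) powr (- (real CARD('m) / 2))"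
    by (simp only: powr_powr) (simp add: mult.commute)
  finally have "(1 / sqrt (2 * pi)) ^ CARD('m) = (2 * pi) powr (- (real CARD('m) / 2))" .
  then show ?thesis
    by (simp only: std_gauss_def std_normal_density_def prod.distrib prod_constant exp_sum[symmetric] finite)
      (simp add: inner_vec_def sum_negf sum_divide_distrib power2_eq_square)
qed

lemma std_gauss_nonneg [simp]: "0 \<le> std_gauss z"
  by (simp add: std_gauss_def prod_nonneg)

lemma has_bochner_integral_std_gauss: "has_bochner_integral lborel (std_gauss :: real^'m \<Rightarrow> real) 1"
proof -
  have "has_bochner_integral lborel (\<lambda>x::real^'m. \<Prod>i\<in>UNIV. std_normal_density (x $ i)) (\<Prod>i\<in>(UNIV::'m set). 1)"
    by (rule has_bochner_integral_lborel_cart_prod[where f = "\<lambda>i. std_normal_density"])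
      (simp add: has_bochner_integral_iff)
  then show ?thesis by (simp add: std_gauss_def[abs_def])
qed

text \<open>Completing the square turns the integrand into a constant times the normal density
  centred at \<open>b\<close>.\<close>

lemma has_bochner_integral_std_normal_exp:
  "has_bochner_integral lborel (\<lambda>x. std_normal_density x * exp (b * x)) (exp (b\<^sup>2 / 2))"
proof -
  have "std_normal_density x * exp (b * x) = exp (b\<^sup>2 / 2) * normal_density b 1 x" for x
    by (simp add: normal_density_def exp_add[symmetric] field_simps power2_eq_square)
  moreover have "has_bochner_integral lborel (\<lambda>x. exp (b\<^sup>2 / 2) * normal_density b 1 x) (exp (b\<^sup>2 / 2) * 1)"
    by (intro has_bochner_integral_mult_right) (simp add: has_bochner_integral_iff)
  ultimately show ?thesis by simp
qed

lemma has_bochner_integral_std_gauss_exp: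
  fixes b :: "real^'m"
  shows "has_bochner_integral lborel (\<lambda>z. std_gauss z * exp (b \<bullet> z)) (exp ((b \<bullet> b) / 2))"
proof -
  have "has_bochner_integral lborel (\<lambda>z::real^'m. \<Prod>i\<in>UNIV. std_normal_density (z $ i) * exp (b $ i * z $ i))
      (\<Prod>i\<in>UNIV. exp ((b $ i)\<^sup>2 / 2))"
    by (rule has_bochner_integral_lborel_cart_prod[OF has_bochner_integral_std_normal_exp])
  then show ?thesis
    by (simp add: std_gauss_def prod.distrib exp_sum[symmetric] inner_vec_def sum_divide_distrib power2_eq_square)
qed

lemma has_bochner_integral_std_gauss_component:
  "has_bochner_integral lborel (\<lambda>z::real^'m. std_gauss z * z $ i) 0"
proof -
  \<comment> \<open>The exponent writes the single coordinate \<open>z $ i\<close> as a product over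
    all coordinates; the factor with \<open>k = i\<close> is an odd moment and vanishes.\<close>
  have "has_bochner_integral lborel (\<lambda>z::real^'m. \<Prod>k\<in>UNIV. std_normal_density (z $ k) * z $ k ^ of_bool (k = i))
      (\<Prod>k\<in>UNIV. of_bool (k \<noteq> i))"
  proof (rule has_bochner_integral_lborel_cart_prod)
    show "has_bochner_integral lborel (\<lambda>x. std_normal_density x * x ^ of_bool (k = i)) (of_bool (k \<noteq> i))" for k
      using std_normal_moment_even[of 0] std_normal_moment_odd[of 0] by auto
  qed
  moreover have "(\<Prod>k\<in>UNIV. z $ k ^ of_bool (k = i)) = z $ i" for z :: "real^'m"
    by (subst prod.remove[of _ i]) (auto intro!: prod.neutral)
  moreover have "(\<Prod>k\<in>UNIV. of_bool (k \<noteq> i) :: real) = 0"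
    by (rule prod_zero) auto
  ultimately show ?thesis by (simp add: std_gauss_def prod.distrib)
qed

lemma has_bochner_integral_std_gauss_components:
  "has_bochner_integral lborel (\<lambda>z::real^'m. std_gauss z * (z $ i * z $ j)) (of_bool (i = j))"
proof -
  \<comment> \<open>\<open>e k\<close> counts how many of \<open>i\<close>, \<open>j\<close> equal
    \<open>k\<close>. The normal moments of order 0, 1, 2 are 1, 0, 1, which is
    \<open>of_bool (e k \<noteq> 1)\<close>; an exponent 1 occurs exactly when \<open>i\<close> and
    \<open>j\<close> differ.\<close>
  define e :: "'m \<Rightarrow> nat" where "e k = of_bool (k = i) + of_bool (k = j)" for k
  have "has_bochner_integral lborel (\<lambda>z::real^'m. \<Prod>k\<in>UNIV. std_normal_density (z $ k) * z $ k ^ e k)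
      (\<Prod>k\<in>UNIV. of_bool (e k \<noteq> 1))"
  proof (rule has_bochner_integral_lborel_cart_prod)
    show "has_bochner_integral lborel (\<lambda>x. std_normal_density x * x ^ e k) (of_bool (e k \<noteq> 1))" for k
      using std_normal_moment_even[of 0] std_normal_moment_odd[of 0] std_normal_moment_even[of 1]
      by (auto simp: e_def numeral_2_eq_2)
  qed
  moreover have "(\<Prod>k\<in>UNIV. z $ k ^ of_bool (k = i)) = z $ i" for z :: "real^'m" and i
    by (subst prod.remove[of _ i]) (auto intro!: prod.neutral)
  moreover have "(\<Prod>k\<in>UNIV. of_bool (e k \<noteq> 1) :: real) = of_bool (i = j)"
  proof (cases "i = j")
    case False
    then show ?thesis by (auto simp: e_def intro!: prod_zero exI[of _ i])
  qed (auto simp: e_def intro!: prod.neutral)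
  ultimately show ?thesis by (simp add: std_gauss_def prod.distrib e_def power_add)
qed

lemma has_bochner_integral_std_gauss_linear:
  fixes b :: "real^'m"
  shows "has_bochner_integral lborel (\<lambda>z. std_gauss z * (b \<bullet> z)) 0"
proof -
  have "has_bochner_integral lborel (\<lambda>z::real^'m. \<Sum>i\<in>UNIV. b $ i * (std_gauss z * z $ i)) (\<Sum>i\<in>UNIV. b $ i * 0)"
    by (intro has_bochner_integral_sum has_bochner_integral_mult_right has_bochner_integral_std_gauss_component)
  then show ?thesis by (simp add: inner_vec_def sum_distrib_left mult.left_commute)
qed

text \<open>The second moments form the identity matrix, so only the diagonal of \<open>M\<close>
  survives.\<close>

lemma has_bochner_integral_std_gauss_quadratic:
  fixes M :: "real^'m^'m"
  shows "has_bochner_integral lborel (\<lambda>z. std_gauss z * (z \<bullet> (M *v z))) (trace M)"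
proof -
  have "has_bochner_integral lborel
      (\<lambda>z::real^'m. \<Sum>i\<in>UNIV. \<Sum>j\<in>UNIV. M $ i $ j * (std_gauss z * (z $ i * z $ j)))
      (\<Sum>i\<in>UNIV. \<Sum>j\<in>UNIV. M $ i $ j * of_bool (i = j))"
    by (intro has_bochner_integral_sum has_bochner_integral_mult_right has_bochner_integral_std_gauss_components)
  moreover have "(\<Sum>i\<in>UNIV. \<Sum>j\<in>UNIV. M $ i $ j * of_bool (i = j)) = trace M"
    by (simp add: trace_def of_bool_def if_distrib[of "\<lambda>x. _ * x"] cong: if_cong)
  moreover have "(\<Sum>i\<in>UNIV. \<Sum>j\<in>UNIV. M $ i $ j * (std_gauss z * (z $ i * z $ j))) = std_gauss z * (z \<bullet> (M *v z))" for z
    by (simp add: inner_vec_def matrix_vector_mult_def sum_distrib_left mult_ac)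
  ultimately show ?thesis by simp
qed

section \<open>Affine substitution and Jensen's inequality\<close>

lemma nn_integral_lborel_affine_cart:
  fixes L :: "real^'m^'m" and f :: "real^'m \<Rightarrow> ennreal"
  assumes "invertible L" and [measurable]: "f \<in> borel_measurable borel"
  shows "(\<integral>\<^sup>+x. f x \<partial>lborel) = ennreal \<bar>det L\<bar> * (\<integral>\<^sup>+z. f (c + L *v z) \<partial>lborel)"
proof -
  have "(\<integral>\<^sup>+x. f x \<partial>lborel) = (\<integral>\<^sup>+x. f x \<partial>distr lborel borel ((+) c))"
    by (simp only: lborel_distr_plus)
  also have "\<dots> = (\<integral>\<^sup>+x. f (c + x) \<partial>lborel)" by (rule nn_integral_distr) measurable
  also have "\<dots> = ennreal \<bar>det L\<bar> * (\<integral>\<^sup>+z. f (c + L *v z) \<partial>lborel)"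
    using assms(1) by (intro nn_integral_lborel_linear) (auto simp: invertible_det_nz)
  finally show ?thesis .
qed

text \<open>The tangent of exp at the mean \<open>E\<close> lies below exp, and its integral against
  the probability density \<open>g\<close> is exactly \<open>exp E\<close>.\<close>

lemma exp_integral_le_integral_exp:
  fixes g h :: "'a \<Rightarrow> real"
  assumes "has_bochner_integral M g 1" "\<And>x. 0 \<le> g x"
    and "has_bochner_integral M (\<lambda>x. g x * h x) E"
    and "integrable M (\<lambda>x. g x * exp (h x))"
  shows "exp E \<le> (LINT x|M. g x * exp (h x))"
proof -
  have *: "has_bochner_integral M (\<lambda>x. exp E * ((1 - E) * g x + g x * h x)) (exp E * ((1 - E) * 1 + E))"
    using assms(1,3) by (intro has_bochner_integral_mult_right has_bochner_integral_add)
  then have "exp E = (LINT x|M. exp E * ((1 - E) * g x + g x * h x))"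
    by (subst has_bochner_integral_integral_eq) simp_all
  also have "\<dots> \<le> (LINT x|M. g x * exp (h x))"
  proof (rule integral_mono)
    show "integrable M (\<lambda>x. exp E * ((1 - E) * g x + g x * h x))"
      using * by (simp add: has_bochner_integral_iff)
    show "integrable M (\<lambda>x. g x * exp (h x))" by fact
    fix x
    have "exp E * (1 + (h x - E)) \<le> exp E * exp (h x - E)"
      by (intro mult_left_mono exp_ge_add_one_self) simp
    also have "\<dots> = exp (h x)" by (simp flip: exp_add)
    finally have "g x * (exp E * (1 + (h x - E))) \<le> g x * exp (h x)"
      using assms(2) by (rule mult_left_mono)
    then show "exp E * ((1 - E) * g x + g x * h x) \<le> g x * exp (h x)"
      by (simp add: algebra_simps)
  qed
  finally show ?thesis .
qed

section \<open>The evidence bound\<close>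

text \<open>From here on \<open>transpose P *v v\<close> is kept in this form, because it is the
  coordinate vector of \<open>v\<close> in a diagonalising basis.\<close>

declare transpose_matrix_vector [simp del]

lemma inner_one_vec: "v \<bullet> (1 :: real^'n) = (\<Sum>i\<in>UNIV. v $ i)"
  by (simp add: inner_vec_def)

section \<open>Inverses, determinants, traces and forms under congruence\<close>

lemma matrix_inv_eqI:
  fixes M N :: "real^'m^'m"
  assumes "M ** N = mat 1"
  shows "matrix_inv M = N"
proof -
  have "M ** N = mat 1 \<and> N ** M = mat 1"
    using assms matrix_left_right_inverse by blast
  then have "M ** matrix_inv M = mat 1 \<and> matrix_inv M ** M = mat 1"
    unfolding matrix_inv_def by (rule someI)
  then show ?thesis using assms by (metis matrix_mul_assoc matrix_mul_lid matrix_mul_rid)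
qed

text \<open>With \<open>K\<close> the inverse of \<open>P\<close>, the inverse of \<open>C\<close>
  is \<open>transpose K ** K\<close>. Substituting \<open>P *v z\<close> therefore turns its
  quadratic form into the Euclidean one.\<close>

lemma congruence_matrix_inv:
  fixes P :: "real^'m^'m"
  assumes "invertible P" "C = P ** transpose P"
  shows "transpose P ** matrix_inv C ** P = mat 1" "transpose (matrix_inv C) = matrix_inv C"
proof -
  obtain K where K: "K ** P = mat 1" "P ** K = mat 1" using assms(1) by (auto simp: invertible_def)
  have Kt: "transpose K ** transpose P = mat 1" "transpose P ** transpose K = mat 1"
    by (metis K matrix_transpose_mul transpose_mat)+
  have "matrix_inv C = transpose K ** K"
  proof (rule matrix_inv_eqI)
    have "C ** (transpose K ** K) = P ** (transpose P ** transpose K) ** K"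
      by (simp add: assms(2) matrix_mul_assoc)
    then show "C ** (transpose K ** K) = mat 1" by (simp add: Kt K)
  qed
  moreover have "transpose P ** (transpose K ** K) ** P = (transpose P ** transpose K) ** (K ** P)"
    by (simp only: matrix_mul_assoc)
  ultimately show "transpose P ** matrix_inv C ** P = mat 1" "transpose (matrix_inv C) = matrix_inv C"
    by (simp_all add: Kt K matrix_transpose_mul)
qed

lemma det_congruence: "det (P ** M ** transpose P) = (det P)\<^sup>2 * det (M :: real^'m^'m)"
  by (simp add: det_mul power2_eq_square)

lemma trace_congruence: "trace (B ** (P ** M ** transpose P)) = trace (transpose P ** B ** P ** (M :: real^'m^'m))"
  by (metis matrix_mul_assoc trace_mul_sym)

lemma inner_matrix_mult_left: "(L *v u) \<bullet> v = u \<bullet> (transpose L *v (v::real^'n))" for L :: "real^'m^'n"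
  by (metis dot_lmul_matrix inner_commute transpose_matrix_vector)

lemma inner_matrix_mult_right: "v \<bullet> (L *v z) = (transpose L *v v) \<bullet> z" for L :: "real^'m^'n"
  by (simp add: transpose_matrix_vector dot_lmul_matrix)

lemma diag_vec_congruence: "diag_vec (A ** C ** transpose A) $ i = row i A \<bullet> (C *v row i A)"
  by (simp add: diag_vec_def row_def inner_vec_def matrix_matrix_mult_def matrix_vector_mult_def
      transpose_def sum_distrib_left sum_distrib_right mult_ac)
    (subst sum.swap, simp add: mult_ac)

section \<open>Integrability of the joint density\<close>

text \<open>For positive \<open>t\<close> use \<open>t\<^sup>2 / 2 \<le> exp t\<close> and complete
  the square; otherwise the linear term is nonpositive. The point is that the bound does not depend
  on \<open>t\<close>.\<close>

lemma poisson_exponent_le: "real k * t - exp t \<le> (real k)\<^sup>2 / 2"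
proof (cases "t \<le> 0")
  case True
  then have "real k * t \<le> 0" by (simp add: mult_nonneg_nonpos)
  moreover have "0 < exp t" "0 \<le> (real k)\<^sup>2 / 2" by simp_all
  ultimately show ?thesis by linarith
next
  case False
  then have "1 + t + t\<^sup>2 / 2 \<le> exp t" by (intro exp_lower_Taylor_quadratic) simp
  moreover have "0 \<le> (real k - t)\<^sup>2" by simp
  ultimately show ?thesis using False by (simp add: power2_diff field_simps)
qed

text \<open>Two vectors, so that one estimate serves twice: \<open>w = v\<close> for the joint
  density, and \<open>w\<close> equal to \<open>v\<close> plus half the variances for
  \<open>lower_bound\<close>.\<close>

lemma poisson_term_le:
  fixes y :: "nat^'n"
  assumes "\<And>i. v $ i \<le> w $ i"
  shows "vec_real y \<bullet> v - 1 \<bullet> vec_exp w \<le> (\<Sum>i\<in>UNIV. (real (y $ i))\<^sup>2 / 2)"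
proof -
  have "vec_real y \<bullet> v - 1 \<bullet> vec_exp w = (\<Sum>i\<in>UNIV. real (y $ i) * v $ i - exp (w $ i))"
    by (simp add: inner_vec_def vec_real_def vec_exp_def sum_subtractf)
  also have "\<dots> \<le> (\<Sum>i\<in>UNIV. (real (y $ i))\<^sup>2 / 2)"
  proof (rule sum_mono)
    fix i
    have "exp (v $ i) \<le> exp (w $ i)" using assms by simp
    then show "real (y $ i) * v $ i - exp (w $ i) \<le> (real (y $ i))\<^sup>2 / 2"
      using poisson_exponent_le[of "y $ i" "v $ i"] by linarith
  qed
  finally show ?thesis .
qed

lemma joint_density_measurable: "(\<lambda>x. joint_density A \<mu>0 C0 x y) \<in> borel_measurable borel"
  unfolding joint_density_def vec_exp_def inner_one_vec vec_lambda_beta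
  by (intro borel_measurable_continuous_onI continuous_intros matrix_vector_mult_linear_continuous_on
      continuous_on_compose2[OF matrix_vector_mult_linear_continuous_on]) auto

lemma joint_density_nonneg: "0 \<le> joint_density A \<mu>0 C0 x y"
  by (simp add: joint_density_def)

text \<open>The Poisson exponent is bounded above, so in coordinates that whiten the prior the
  density is at most a multiple of \<open>std_gauss\<close>.\<close>

lemma integrable_joint_density:
  fixes C0 :: "real^'m^'m"
  assumes "C0 \<in> spd_matrices"
  shows "integrable lborel (\<lambda>x. joint_density A \<mu>0 C0 x y)"
proof -
  obtain L :: "real^'m^'m" where L: "invertible L" "C0 = L ** transpose L"
    using spd_factorization[OF assms] by blast
  note inv = congruence_matrix_inv[OF L]
  define K where "K = det C0 powr (- (1/2)) * exp ((\<Sum>i\<in>UNIV. (real (y $ i))\<^sup>2 / 2) - vec_ln (vec_fact y) \<bullet> 1)"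
  have bound: "joint_density A \<mu>0 C0 (\<mu>0 + L *v z) y \<le> K * std_gauss z" for z
  proof -
    have quad: "(L *v z) \<bullet> (matrix_inv C0 *v (L *v z)) = z \<bullet> z"
      unfolding inner_matrix_mult_left matrix_vector_mul_assoc by (simp add: inv matrix_mul_assoc)
    let ?S = "(\<Sum>i\<in>UNIV. (real (y $ i))\<^sup>2 / 2) - vec_ln (vec_fact y) \<bullet> 1"
    have "joint_density A \<mu>0 C0 (\<mu>0 + L *v z) y = (2 * pi) powr (- (real CARD('m) / 2)) * det C0 powr (- (1/2)) *
        exp ((A *v (\<mu>0 + L *v z)) \<bullet> vec_real y - vec_exp (A *v (\<mu>0 + L *v z)) \<bullet> 1
          - vec_ln (vec_fact y) \<bullet> 1 - 1/2 * (z \<bullet> z))"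
      by (simp add: joint_density_def quad)
    also have "\<dots> \<le> (2 * pi) powr (- (real CARD('m) / 2)) * det C0 powr (- (1/2)) * exp (?S + - (z \<bullet> z) / 2)"
      using poisson_term_le[of "A *v (\<mu>0 + L *v z)" "A *v (\<mu>0 + L *v z)" y]
      by (intro mult_left_mono) (simp_all add: inner_commute)
    also have "\<dots> = K * std_gauss z"
      unfolding K_def std_gauss_eq exp_add by simp
    finally show ?thesis .
  qed
  have "(\<integral>\<^sup>+x. ennreal (joint_density A \<mu>0 C0 x y) \<partial>lborel)
      = ennreal \<bar>det L\<bar> * (\<integral>\<^sup>+z. ennreal (joint_density A \<mu>0 C0 (\<mu>0 + L *v z) y) \<partial>lborel)"
    using joint_density_measurable by (intro nn_integral_lborel_affine_cart L(1)) measurable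
  also have "\<dots> \<le> ennreal \<bar>det L\<bar> * (\<integral>\<^sup>+z. ennreal (K * std_gauss (z :: real^'m)) \<partial>lborel)"
    by (intro mult_left_mono nn_integral_mono ennreal_leI bound) simp
  also have "(\<integral>\<^sup>+z. ennreal (K * std_gauss (z :: real^'m)) \<partial>lborel) = ennreal (K * 1)"
    using has_bochner_integral_mult_right[OF has_bochner_integral_std_gauss, of K]
    by (subst nn_integral_eq_integral) (auto simp: has_bochner_integral_iff K_def)
  finally have "(\<integral>\<^sup>+x. ennreal (joint_density A \<mu>0 C0 x y) \<partial>lborel) < \<infinity>"
    by (simp add: ennreal_mult_less_top le_less_trans)
  then show ?thesis
    using joint_density_measurable by (simp add: integrable_iff_bounded joint_density_nonneg)
qed

theorem lower_bound_le_ln_evidence: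
  fixes C0 C :: "real^'m^'m"
  assumes C0: "C0 \<in> spd_matrices" and C: "C \<in> spd_matrices"
  shows "lower_bound A y \<mu>0 C0 x C \<le> ln (evidence A \<mu>0 C0 y)"
proof -
  obtain L :: "real^'m^'m" where L: "invertible L" "C = L ** transpose L"
    using spd_factorization[OF C] by blast
  obtain L0 :: "real^'m^'m" where L0: "invertible L0" "C0 = L0 ** transpose L0"
    using spd_factorization[OF C0] by blast
  define B where "B = matrix_inv C0"
  define d where "d = x - \<mu>0"
  \<comment> \<open>The Jacobian is included, so the integral of \<open>f\<close> is the
    evidence.\<close>
  define f where "f z = joint_density A \<mu>0 C0 (x + L *v z) y * \<bar>det L\<bar>" for z
  define c where "c = 1/2 * ln (det C) - 1/2 * ln (det C0) - vec_ln (vec_fact y) \<bullet> 1"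
  \<comment> \<open>All that is linear in \<open>z\<close>: the Poisson term and the two cross terms
    of the prior form.\<close>
  define b where "b = transpose L *v (transpose A *v vec_real y)
      - (1/2) *\<^sub>R (transpose L *v (B *v d)) - (1/2) *\<^sub>R (transpose L *v (transpose B *v d))"
  \<comment> \<open>The last summand makes up for the Gaussian exponent that
    \<open>std_gauss\<close> takes out. Its mean is \<open>real CARD('m) / 2\<close>, and the
    Jacobian enters \<open>c\<close> as \<open>1/2 * ln (det C)\<close>: these are the entropy terms
    of \<open>lower_bound\<close>.\<close>
  define h where "h z = (c + vec_real y \<bullet> (A *v x) - 1/2 * (d \<bullet> (B *v d))) + b \<bullet> z
      - (\<Sum>i\<in>UNIV. exp ((A *v x) $ i) * exp ((transpose L *v row i A) \<bullet> z))
      - 1/2 * (z \<bullet> ((transpose L ** B ** L) *v z)) + 1/2 * (z \<bullet> (mat 1 *v z))" for z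
  have detC: "det C = (det L)\<^sup>2" "det L \<noteq> 0" "det C0 > 0"
    using L L0 by (auto simp: det_mul power2_eq_square[symmetric] invertible_det_nz)
  have f_eq: "f z = std_gauss z * exp (h z)" for z
  proof -
    have quad: "(d + L *v z) \<bullet> (B *v (d + L *v z)) = d \<bullet> (B *v d)
        + (transpose L *v (B *v d)) \<bullet> z + (transpose L *v (transpose B *v d)) \<bullet> z
        + z \<bullet> ((transpose L ** B ** L) *v z)"
    proof -
      have "(L *v z) \<bullet> (B *v d) = (transpose L *v (B *v d)) \<bullet> z"
        by (subst inner_matrix_mult_left) (rule inner_commute)
      moreover have "d \<bullet> (B *v (L *v z)) = (transpose L *v (transpose B *v d)) \<bullet> z"
        by (simp add: inner_matrix_mult_right)
      moreover have "(L *v z) \<bullet> (B *v (L *v z)) = z \<bullet> ((transpose L ** B ** L) *v z)"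
        by (simp add: inner_matrix_mult_left matrix_vector_mul_assoc matrix_mul_assoc)
      ultimately show ?thesis
        by (simp add: matrix_vector_right_distrib inner_add_left inner_add_right)
    qed
    have lin: "(A *v (x + L *v z)) \<bullet> vec_real y
        = vec_real y \<bullet> (A *v x) + (transpose L *v (transpose A *v vec_real y)) \<bullet> z"
      by (simp add: matrix_vector_right_distrib inner_commute[of _ "vec_real y"] inner_add_right
          inner_matrix_mult_right)
    have vexp: "vec_exp (A *v (x + L *v z)) \<bullet> 1
        = (\<Sum>i\<in>UNIV. exp ((A *v x) $ i) * exp ((transpose L *v row i A) \<bullet> z))"
    proof -
      have "(A *v (L *v z)) $ i = (transpose L *v row i A) \<bullet> z" for i
        by (simp add: matrix_vector_mul_component[of A] row_def vec_lambda_eta inner_matrix_mult_right)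
      then show ?thesis
        by (simp add: vec_exp_def inner_one_vec matrix_vector_right_distrib exp_add)
    qed
    have dets: "det C0 powr (- (1/2)) * \<bar>det L\<bar> = exp (1/2 * ln (det C) - 1/2 * ln (det C0))"
    proof -
      have "ln (det C) = 2 * ln \<bar>det L\<bar>"
        using detC ln_realpow[of "\<bar>det L\<bar>" 2] by simp
      then have "\<bar>det L\<bar> = exp (1/2 * ln (det C))" using detC(2) by simp
      moreover have "det C0 powr (- (1/2)) = exp (- (1/2 * ln (det C0)))"
        using detC(3) by (simp add: powr_def)
      ultimately show ?thesis by (simp only: exp_add[symmetric]) simp
    qed
    let ?X = "(A *v (x + L *v z)) \<bullet> vec_real y - vec_exp (A *v (x + L *v z)) \<bullet> 1
      - vec_ln (vec_fact y) \<bullet> 1 - 1/2 * ((d + L *v z) \<bullet> (B *v (d + L *v z)))"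
    have X: "?X + (1/2 * ln (det C) - 1/2 * ln (det C0)) = - (z \<bullet> z) / 2 + h z"
      unfolding quad lin vexp h_def c_def b_def
      by (simp add: inner_diff_left inner_add_left field_simps)
    have "x + L *v z - \<mu>0 = d + L *v z" by (simp add: d_def)
    note this [simp]
    have "f z = (2 * pi) powr (- (real CARD('m) / 2)) * exp ?X * (det C0 powr (- (1/2)) * \<bar>det L\<bar>)"
      unfolding f_def joint_density_def B_def by simp
    also have "\<dots> = (2 * pi) powr (- (real CARD('m) / 2)) * exp (- (z \<bullet> z) / 2 + h z)"
      unfolding dets X[symmetric] exp_add by simp
    finally show ?thesis unfolding std_gauss_eq exp_add by simp
  qed
  have hb: "has_bochner_integral lborel (\<lambda>z. std_gauss z * h z) (lower_bound A y \<mu>0 C0 x C)"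
  proof -
    have "has_bochner_integral lborel (\<lambda>z. (c + vec_real y \<bullet> (A *v x) - 1/2 * (d \<bullet> (B *v d))) * std_gauss z
        + std_gauss z * (b \<bullet> z)
        - (\<Sum>i\<in>UNIV. exp ((A *v x) $ i) * (std_gauss z * exp ((transpose L *v row i A) \<bullet> z)))
        - 1/2 * (std_gauss z * (z \<bullet> ((transpose L ** B ** L) *v z))) + 1/2 * (std_gauss z * (z \<bullet> (mat 1 *v z))))
      ((c + vec_real y \<bullet> (A *v x) - 1/2 * (d \<bullet> (B *v d))) * 1 + 0
        - (\<Sum>i\<in>UNIV. exp ((A *v x) $ i) * exp ((transpose L *v row i A) \<bullet> (transpose L *v row i A) / 2))
        - 1/2 * trace (transpose L ** B ** L) + 1/2 * trace (mat 1 :: real^'m^'m))"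
      by (intro has_bochner_integral_add has_bochner_integral_diff has_bochner_integral_sum
          has_bochner_integral_mult_right has_bochner_integral_std_gauss has_bochner_integral_std_gauss_linear
          has_bochner_integral_std_gauss_exp has_bochner_integral_std_gauss_quadratic)
    moreover have "trace (transpose L ** B ** L) = trace (B ** C)"
      using trace_congruence[of B L "mat 1"] by (simp add: L(2))
    \<comment> \<open>The Gaussian exponential moment produces half of this squared norm, which is
      the variance of the i-th entry of \<open>A *v X\<close> under covariance
      \<open>C\<close>.\<close>
    moreover have "(transpose L *v row i A) \<bullet> (transpose L *v row i A) = diag_vec (A ** C ** transpose A) $ i" for i
      unfolding diag_vec_congruence L(2) using inner_congruence[of "row i A" L "mat 1"] by simp
    ultimately show ?thesis
      by (simp add: lower_bound_def h_def c_def B_def d_def vec_exp_def inner_one_vec inner_commute[of 1]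
          trace_I exp_add algebra_simps sum_distrib_left)
  qed
  have meas [measurable]: "(\<lambda>z. L *v z) \<in> borel_measurable borel"
    by (intro borel_measurable_continuous_onI matrix_vector_mult_linear_continuous_on)
  \<comment> \<open>Equality of the nonnegative integrals transfers both the value of the evidence
    and finiteness, hence integrability of \<open>f\<close>.\<close>
  have ff: "(\<integral>\<^sup>+z. ennreal (f z) \<partial>lborel) = (\<integral>\<^sup>+x. ennreal (joint_density A \<mu>0 C0 x y) \<partial>lborel)"
  proof -
    have "(\<integral>\<^sup>+x. ennreal (joint_density A \<mu>0 C0 x y) \<partial>lborel)
        = ennreal \<bar>det L\<bar> * (\<integral>\<^sup>+z. ennreal (joint_density A \<mu>0 C0 (x + L *v z) y) \<partial>lborel)"
      using joint_density_measurable by (intro nn_integral_lborel_affine_cart L(1)) measurable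
    also have "\<dots> = (\<integral>\<^sup>+z. ennreal \<bar>det L\<bar> * ennreal (joint_density A \<mu>0 C0 (x + L *v z) y) \<partial>lborel)"
      by (rule nn_integral_cmult[symmetric])
        (use joint_density_measurable[of A \<mu>0 C0 y] in measurable)
    finally show ?thesis
      by (simp add: f_def ennreal_mult[symmetric] joint_density_nonneg mult.commute)
  qed
  have fnn: "0 \<le> f z" for z by (simp add: f_def joint_density_nonneg)
  have fm: "f \<in> borel_measurable borel"
    unfolding f_def[abs_def] using joint_density_measurable[of A \<mu>0 C0 y] by measurable
  have Z: "evidence A \<mu>0 C0 y = (LINT z|lborel. f z)"
    unfolding evidence_def
    by (subst (1 2) integral_eq_nn_integral)
      (use fm joint_density_measurable ff in \<open>auto simp: fnn joint_density_nonneg\<close>)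
  have "(\<integral>\<^sup>+x. ennreal (joint_density A \<mu>0 C0 x y) \<partial>lborel) < \<infinity>"
    using integrable_joint_density[OF C0, of A \<mu>0 y] by (simp add: integrable_iff_bounded joint_density_nonneg)
  then have "integrable lborel f"
    using fm by (simp add: integrable_iff_bounded fnn ff)
  then have "exp (lower_bound A y \<mu>0 C0 x C) \<le> evidence A \<mu>0 C0 y"
    unfolding Z f_eq[abs_def]
    by (intro exp_integral_le_integral_exp[OF has_bochner_integral_std_gauss _ hb]) auto
  then show ?thesis
    by (metis exp_gt_zero less_le_trans ln_exp ln_le_cancel_iff)
qed

section \<open>Strict concavity\<close>

lemma spd_congruence_diag_iff:
  fixes P :: "real^'m^'m"
  assumes "invertible P"
  shows "P ** diag_mat d ** transpose P \<in> spd_matrices \<longleftrightarrow> (\<forall>i. 0 < d i)"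
proof -
  obtain K where K: "K ** P = mat 1" "P ** K = mat 1" using assms by (auto simp: invertible_def)
  have KP: "transpose P *v (transpose K *v v) = v" "transpose K *v (transpose P *v v) = v" for v
    by (simp_all add: matrix_vector_mul_assoc matrix_transpose_mul[symmetric] K)
  have form: "v \<bullet> ((P ** diag_mat d ** transpose P) *v v) = (\<Sum>i\<in>UNIV. d i * ((transpose P *v v) $ i)\<^sup>2)" for v
    by (simp add: inner_congruence inner_diag_mat)
  have sym: "transpose (P ** diag_mat d ** transpose P) = P ** diag_mat d ** transpose P"
    by (simp add: matrix_transpose_mul matrix_mul_assoc)
  show ?thesis
  proof
    assume spd: "P ** diag_mat d ** transpose P \<in> spd_matrices"
    show "\<forall>i. 0 < d i"
    proof
      fix i
      \<comment> \<open>\<open>transpose K\<close> inverts \<open>transpose P\<close>, so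
        \<open>?v\<close> has coordinate vector \<open>axis i 1\<close> and isolates
        \<open>d i\<close>.\<close>
      let ?v = "transpose K *v axis i 1"
      have "?v \<noteq> 0" using KP(1)[of "axis i 1"] by (metis axis_eq_0_iff matrix_vector_mult_0_right zero_neq_one)
      then have "0 < ?v \<bullet> ((P ** diag_mat d ** transpose P) *v ?v)"
        using spd unfolding spd_matrices_def by blast
      then have "0 < (\<Sum>k\<in>UNIV. d k * (axis i 1 $ k)\<^sup>2)"
        unfolding form KP .
      then show "0 < d i"
        by (simp add: axis_def if_distrib[of "\<lambda>x. x ^ 2"] if_distrib[of "\<lambda>x. _ * x"] cong: if_cong)
    qed
  next
    assume d: "\<forall>i. 0 < d i"
    have "0 < v \<bullet> ((P ** diag_mat d ** transpose P) *v v)" if "v \<noteq> 0" for v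
    proof -
      have "transpose P *v v \<noteq> 0" using KP(2)[of v] that by (metis matrix_vector_mult_0_right)
      then obtain i where "(transpose P *v v) $ i \<noteq> 0" by (auto simp: vec_eq_iff)
      then show ?thesis unfolding form using d by (intro sum_pos2[of _ i]) (auto simp: less_imp_le)
    qed
    with sym show "P ** diag_mat d ** transpose P \<in> spd_matrices" by (simp add: spd_matrices_def)
  qed
qed

lemma spd_simultaneous_diagonalization:
  fixes C D :: "real^'m^'m"
  assumes "C \<in> spd_matrices" "D \<in> spd_matrices"
  obtains P :: "real^'m^'m" and d where "invertible P" "C = P ** transpose P"
    "D = P ** diag_mat d ** transpose P" "\<And>i. 0 < d i"
proof -
  have "transpose D = D" using assms(2) by (simp add: spd_matrices_def)
  from simultaneous_diagonalization[OF assms(1) this]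
  obtain P :: "real^'m^'m" and d where P: "invertible P" "C = P ** transpose P" "D = P ** diag_mat d ** transpose P"
    by blast
  moreover have "0 < d i" for i using assms(2) spd_congruence_diag_iff[OF P(1)] P(3) by simp
  ultimately show thesis using that by blast
qed

lemma trace_inv_congruence:
  fixes P :: "real^'m^'m"
  assumes "invertible P" "C = P ** transpose P"
  shows "trace (matrix_inv C ** (P ** diag_mat d ** transpose P)) = (\<Sum>i\<in>UNIV. d i)"
  unfolding trace_congruence by (simp add: congruence_matrix_inv[OF assms] trace_diag_mat)

lemma ln_det_congruence_diag:
  fixes P :: "real^'m^'m"
  assumes "invertible P" "\<And>i. 0 < d i"
  shows "ln (det (P ** diag_mat d ** transpose P)) = ln (det (P ** transpose P)) + (\<Sum>i\<in>UNIV. ln (d i))"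
proof -
  have nz: "d i \<noteq> 0" for i using assms(2)[of i] by simp
  have "ln (det (P ** diag_mat d ** transpose P)) = ln ((det P)\<^sup>2 * (\<Prod>i\<in>UNIV. d i))"
    by (simp add: det_congruence det_diag_mat)
  also have "\<dots> = ln ((det P)\<^sup>2) + (\<Sum>i\<in>UNIV. ln (d i))"
    using assms(1) nz by (subst ln_mult) (auto simp: invertible_det_nz ln_prod)
  finally show ?thesis by (simp add: det_mul power2_eq_square)
qed

lemma congruence_add_scaleR:
  fixes M N P :: "real^'m^'m"
  shows "P ** (M + t *\<^sub>R N) ** Q = P ** M ** Q + t *\<^sub>R (P ** N ** Q)"
  by (simp add: vec_eq_iff matrix_matrix_mult_def sum.distrib sum_distrib_left sum_distrib_right algebra_simps)

lemma diag_congruence_diff: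
  fixes P :: "real^'m^'m"
  shows "P ** diag_mat d ** transpose P - P ** transpose P = P ** diag_mat (\<lambda>i. d i - 1) ** transpose P"
proof -
  have "diag_mat d = mat 1 + 1 *\<^sub>R diag_mat (\<lambda>i. d i - 1)"
    by (simp add: diag_mat_one[symmetric] diag_mat_add)
  then show ?thesis by (simp only: congruence_add_scaleR) simp
qed

lemma ln_det_supergradient:
  fixes C D :: "real^'m^'m"
  assumes "C \<in> spd_matrices" "D \<in> spd_matrices"
  shows "ln (det D) \<le> ln (det C) + trace (matrix_inv C ** (D - C))"
    and "D \<noteq> C \<Longrightarrow> ln (det D) < ln (det C) + trace (matrix_inv C ** (D - C))"
proof -
  obtain P :: "real^'m^'m" and d where P: "invertible P" "C = P ** transpose P"
    "D = P ** diag_mat d ** transpose P" and d: "\<And>i. 0 < d i"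
    using spd_simultaneous_diagonalization[OF assms] by blast
  have tr: "trace (matrix_inv C ** (D - C)) = (\<Sum>i\<in>UNIV. d i - 1)"
    using trace_inv_congruence[OF P(1,2)] diag_congruence_diff[of P d] P(2,3) by metis
  have ld: "ln (det D) = ln (det C) + (\<Sum>i\<in>UNIV. ln (d i))"
    using ln_det_congruence_diag[OF P(1) d] P(2,3) by simp
  show "ln (det D) \<le> ln (det C) + trace (matrix_inv C ** (D - C))"
    unfolding tr ld using d by (simp add: sum_mono ln_le_minus_one)
  assume "D \<noteq> C"
  have "\<exists>i. d i \<noteq> 1"
  proof (rule ccontr)
    assume "\<nexists>i. d i \<noteq> 1"
    then have "d = (\<lambda>i. 1)" by auto
    then show False using \<open>D \<noteq> C\<close> P(2,3) by (simp add: diag_mat_one)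
  qed
  \<comment> \<open>Equality in \<open>ln d \<le> d - 1\<close> holds only at 1, so a single
    relative eigenvalue other than 1 makes the sum strict.\<close>
  then obtain i where "d i \<noteq> 1" by blast
  then have "ln (d i) < d i - 1"
    using d[of i] ln_le_minus_one[of "d i"] ln_eq_minus_one[of "d i"] by fastforce
  then have "(\<Sum>i\<in>UNIV. ln (d i)) < (\<Sum>i\<in>UNIV. d i - 1)"
    using d by (intro sum_strict_mono_ex1) (auto intro: ln_le_minus_one)
  then show "ln (det D) < ln (det C) + trace (matrix_inv C ** (D - C))"
    unfolding tr ld by simp
qed

section \<open>First-order conditions for the bound\<close>

text \<open>Logarithm of the mean of \<open>exp ((A *v X) $ i)\<close> for \<open>X\<close> Gaussian
  with mean \<open>x\<close> and covariance \<open>C\<close>: mean plus half the variance. It is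
  linear in \<open>x\<close> and \<open>C\<close> jointly.\<close>

definition log_rate :: "real^'m^'n \<Rightarrow> real^'m \<Rightarrow> real^'m^'m \<Rightarrow> 'n \<Rightarrow> real" where
  "log_rate A x C i = (A *v x) $ i + 1/2 * (row i A \<bullet> (C *v row i A))"

lemma lower_bound_alt:
  "lower_bound A y \<mu>0 C0 x C = vec_real y \<bullet> (A *v x) - (\<Sum>i\<in>UNIV. exp (log_rate A x C i))
     - 1/2 * ((x - \<mu>0) \<bullet> (matrix_inv C0 *v (x - \<mu>0))) - 1/2 * trace (matrix_inv C0 ** C)
     + 1/2 * ln (det C) - 1/2 * ln (det C0) + real CARD('m) / 2 - 1 \<bullet> vec_ln (vec_fact y)"
  for x :: "real^'m"
  by (simp add: lower_bound_def vec_exp_def inner_commute[of 1] inner_one_vec log_rate_def diag_vec_congruence)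

text \<open>Derivative of \<open>lower_bound\<close> in the mean, in direction
  \<open>h\<close>.\<close>

definition mean_slope ::
  "real^'m^'n \<Rightarrow> nat^'n \<Rightarrow> real^'m \<Rightarrow> real^'m^'m \<Rightarrow> real^'m \<Rightarrow> real^'m^'m \<Rightarrow> real^'m \<Rightarrow> real" where
  "mean_slope A y \<mu>0 C0 x C h = vec_real y \<bullet> (A *v h) - (\<Sum>i\<in>UNIV. exp (log_rate A x C i) * (A *v h) $ i)
     - h \<bullet> (matrix_inv C0 *v (x - \<mu>0))"

text \<open>Derivative of \<open>lower_bound\<close> in the covariance, in direction
  \<open>H\<close>; the last trace comes from the log determinant.\<close>

definition cov_slope ::
  "real^'m^'n \<Rightarrow> real^'m^'m \<Rightarrow> real^'m \<Rightarrow> real^'m^'m \<Rightarrow> real^'m^'m \<Rightarrow> real" where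
  "cov_slope A C0 x C H = - (\<Sum>i\<in>UNIV. exp (log_rate A x C i) * (1/2 * (row i A \<bullet> (H *v row i A))))
     - 1/2 * trace (matrix_inv C0 ** H) + 1/2 * trace (matrix_inv C ** H)"

lemma log_rate_diff:
  "log_rate A u D i - log_rate A x C i = (A *v (u - x)) $ i + 1/2 * (row i A \<bullet> ((D - C) *v row i A))"
  by (simp add: log_rate_def matrix_vector_mult_diff_distrib matrix_vector_mult_diff_rdistrib inner_diff_right
      right_diff_distrib)

lemma spd_matrix_inv:
  fixes C :: "real^'m^'m"
  assumes "C \<in> spd_matrices"
  shows "matrix_inv C \<in> spd_matrices"
proof -
  obtain L :: "real^'m^'m" where L: "invertible L" "C = L ** transpose L"
    using spd_factorization[OF assms] by blast
  note inv = congruence_matrix_inv[OF L]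
  have "0 < v \<bullet> (matrix_inv C *v v)" if "v \<noteq> 0" for v
  proof -
    obtain K where K: "L ** K = mat 1" using L(1) by (auto simp: invertible_def)
    then have v: "v = L *v (K *v v)" by (simp add: matrix_vector_mul_assoc)
    have "v \<bullet> (matrix_inv C *v v) = (L *v (K *v v)) \<bullet> (matrix_inv C *v (L *v (K *v v)))"
      by (simp add: v[symmetric])
    also have "\<dots> = (K *v v) \<bullet> (K *v v)"
      by (subst inner_matrix_mult_left) (simp only: matrix_vector_mul_assoc matrix_mul_assoc inv matrix_mul_lid)
    finally show ?thesis using v that by (metis inner_gt_zero_iff matrix_vector_mult_0_right)
  qed
  then show ?thesis by (simp add: spd_matrices_def inv)
qed

text \<open>Each nonlinear piece is compared with its own tangent. Linearity of
  \<open>log_rate\<close> in the pair makes the tangent of exp split into a mean part and a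
  covariance part.\<close>

theorem lower_bound_supergradient:
  fixes C0 C D :: "real^'m^'m"
  assumes C0: "C0 \<in> spd_matrices" and C: "C \<in> spd_matrices" "D \<in> spd_matrices"
    and ne: "(u, D) \<noteq> (x, C)"
  shows "lower_bound A y \<mu>0 C0 u D
    < lower_bound A y \<mu>0 C0 x C + mean_slope A y \<mu>0 C0 x C (u - x) + cov_slope A C0 x C (D - C)"
proof -
  let ?B = "matrix_inv C0" and ?h = "u - x" and ?H = "D - C"
  have B: "?B \<in> spd_matrices" using spd_matrix_inv[OF C0] .
  have exps: "(\<Sum>i\<in>UNIV. exp (log_rate A x C i)) + (\<Sum>i\<in>UNIV. exp (log_rate A x C i) * (A *v ?h) $ i)
      + (\<Sum>i\<in>UNIV. exp (log_rate A x C i) * (1/2 * (row i A \<bullet> (?H *v row i A))))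
      \<le> (\<Sum>i\<in>UNIV. exp (log_rate A u D i))"
    unfolding sum.distrib[symmetric]
  proof (rule sum_mono)
    fix i
    have "exp (log_rate A x C i) * (1 + (log_rate A u D i - log_rate A x C i))
        \<le> exp (log_rate A x C i) * exp (log_rate A u D i - log_rate A x C i)"
      by (intro mult_left_mono exp_ge_add_one_self) simp
    also have "\<dots> = exp (log_rate A u D i)" by (simp add: exp_add[symmetric])
    finally show "exp (log_rate A x C i) + exp (log_rate A x C i) * (A *v ?h) $ i
        + exp (log_rate A x C i) * (1/2 * (row i A \<bullet> (?H *v row i A))) \<le> exp (log_rate A u D i)"
      unfolding log_rate_diff by (simp add: algebra_simps)
  qed
  have sym: "(x - \<mu>0) \<bullet> (?B *v ?h) = ?h \<bullet> (?B *v (x - \<mu>0))"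
    using B symmetric_matrix_inner[of ?B "x - \<mu>0" ?h] by (simp add: spd_matrices_def inner_commute)
  have "u - \<mu>0 = (x - \<mu>0) + ?h" by simp
  then have quad: "(u - \<mu>0) \<bullet> (?B *v (u - \<mu>0)) = (x - \<mu>0) \<bullet> (?B *v (x - \<mu>0))
      + 2 * (?h \<bullet> (?B *v (x - \<mu>0))) + ?h \<bullet> (?B *v ?h)"
    using sym by (simp only: matrix_vector_right_distrib inner_add_left inner_add_right)
  have pos: "0 \<le> ?h \<bullet> (?B *v ?h)" "u \<noteq> x \<Longrightarrow> 0 < ?h \<bullet> (?B *v ?h)"
    using B by (cases "u = x"; simp add: spd_matrices_def less_imp_le)+
  have tr: "trace (?B ** D) = trace (?B ** C) + trace (?B ** ?H)"
    by (simp add: trace_add[symmetric] matrix_add_ldistrib[symmetric])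
  have lin: "vec_real y \<bullet> (A *v u) = vec_real y \<bullet> (A *v x) + vec_real y \<bullet> (A *v ?h)"
    by (simp add: matrix_vector_mult_diff_distrib inner_diff_right)
  \<comment> \<open>Source of strictness: the prior form if the means differ, otherwise the log
    determinant.\<close>
  have "1/2 * (?h \<bullet> (?B *v ?h)) + 1/2 * (ln (det C) + trace (matrix_inv C ** ?H) - ln (det D)) > 0"
  proof (cases "u = x")
    case True
    then show ?thesis using ne ln_det_supergradient(2)[OF C] by simp
  next
    case False
    then have "0 < ?h \<bullet> (?B *v ?h)" by (rule pos(2))
    moreover have "0 \<le> ln (det C) + trace (matrix_inv C ** ?H) - ln (det D)"
      using ln_det_supergradient(1)[OF C] by simp
    ultimately show ?thesis by (intro add_pos_nonneg mult_pos_pos mult_nonneg_nonneg) simp_all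
  qed
  then show ?thesis
    using exps unfolding lower_bound_alt mean_slope_def cov_slope_def quad tr lin by (simp add: algebra_simps)
qed

lemma mean_slope_nonpos:
  fixes C0 C :: "real^'m^'m"
  assumes max: "\<And>v. lower_bound A y \<mu>0 C0 v C \<le> lower_bound A y \<mu>0 C0 x C"
    and C0: "C0 \<in> spd_matrices"
  shows "mean_slope A y \<mu>0 C0 x C h \<le> 0"
proof (rule ccontr)
  assume "\<not> ?thesis"
  let ?B = "matrix_inv C0"
  have sym: "(x - \<mu>0) \<bullet> (?B *v h) = h \<bullet> (?B *v (x - \<mu>0))"
    using spd_matrix_inv[OF C0] symmetric_matrix_inner[of ?B "x - \<mu>0" h] by (simp add: spd_matrices_def inner_commute)
  define g where "g t = vec_real y \<bullet> (A *v x) + t * (vec_real y \<bullet> (A *v h))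
      - (\<Sum>i\<in>UNIV. exp (log_rate A x C i + t * (A *v h) $ i))
      - 1/2 * ((x - \<mu>0) \<bullet> (?B *v (x - \<mu>0)) + 2 * t * (h \<bullet> (?B *v (x - \<mu>0))) + t\<^sup>2 * (h \<bullet> (?B *v h)))
      + (- 1/2 * trace (?B ** C) + 1/2 * ln (det C) - 1/2 * ln (det C0) + real CARD('m) / 2
          - 1 \<bullet> vec_ln (vec_fact y))" for t
  have g: "lower_bound A y \<mu>0 C0 (x + t *\<^sub>R h) C = g t" for t
  proof -
    have "x + t *\<^sub>R h - \<mu>0 = (x - \<mu>0) + t *\<^sub>R h" by simp
    then have "(x + t *\<^sub>R h - \<mu>0) \<bullet> (?B *v (x + t *\<^sub>R h - \<mu>0))
        = (x - \<mu>0) \<bullet> (?B *v (x - \<mu>0)) + 2 * t * (h \<bullet> (?B *v (x - \<mu>0))) + t\<^sup>2 * (h \<bullet> (?B *v h))"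
      using sym by (simp only: matrix_vector_right_distrib inner_add_left inner_add_right
          matrix_vector_mult_scaleR inner_scaleR_left inner_scaleR_right) (simp add: algebra_simps power2_eq_square)
    moreover have "log_rate A (x + t *\<^sub>R h) C i = log_rate A x C i + t * (A *v h) $ i" for i
      by (simp add: log_rate_def matrix_vector_right_distrib matrix_vector_mult_scaleR)
    ultimately show ?thesis
      unfolding lower_bound_alt g_def
      by (simp add: matrix_vector_right_distrib matrix_vector_mult_scaleR inner_add_right)
  qed
  have "(g has_real_derivative mean_slope A y \<mu>0 C0 x C h) (at 0)"
    unfolding g_def mean_slope_def by (auto intro!: derivative_eq_intros simp: algebra_simps)
  with \<open>\<not> ?thesis\<close> obtain e where "e > 0" "\<And>t. 0 < t \<Longrightarrow> t < e \<Longrightarrow> g 0 < g (0 + t)"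
    using DERIV_pos_inc_right[of g "mean_slope A y \<mu>0 C0 x C h" 0] by (auto simp: not_le)
  from this(2)[of "e / 2"] \<open>e > 0\<close> have "g 0 < g (e / 2)" by simp
  then show False using max[of "x + (e / 2) *\<^sub>R h"] g[of 0] g[of "e / 2"] by simp
qed

text \<open>The segment from \<open>C\<close> to \<open>D\<close> stays among the admissible
  covariances. In a basis diagonalising both ends its log determinant is, up to a constant, a sum of
  \<open>ln (1 + t * (d i - 1))\<close>, so no derivative of \<open>det\<close> has to be
  computed.\<close>

lemma cov_slope_nonpos:
  fixes C0 C D :: "real^'m^'m"
  assumes max: "\<And>E. E \<in> spd_matrices \<Longrightarrow> lower_bound A y \<mu>0 C0 x E \<le> lower_bound A y \<mu>0 C0 x C"
    and CD: "C \<in> spd_matrices" "D \<in> spd_matrices"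
  shows "cov_slope A C0 x C (D - C) \<le> 0"
proof (rule ccontr)
  assume "\<not> ?thesis"
  let ?B = "matrix_inv C0" and ?H = "D - C"
  obtain P :: "real^'m^'m" and d where P: "invertible P" "C = P ** transpose P"
    "D = P ** diag_mat d ** transpose P" and d: "\<And>i. 0 < d i"
    using spd_simultaneous_diagonalization[OF CD] by blast
  have tr: "trace (matrix_inv C ** ?H) = (\<Sum>i\<in>UNIV. d i - 1)"
    using trace_inv_congruence[OF P(1,2)] diag_congruence_diff[of P d] P(2,3) by metis
  define g where "g t = (- (\<Sum>i\<in>UNIV. exp (log_rate A x C i + t * (1/2 * (row i A \<bullet> (?H *v row i A)))))
      - 1/2 * (trace (?B ** C) + t * trace (?B ** ?H))
      + 1/2 * (ln (det C) + (\<Sum>i\<in>UNIV. ln (1 + t * (d i - 1))))) +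
      (vec_real y \<bullet> (A *v x) - 1/2 * ((x - \<mu>0) \<bullet> (?B *v (x - \<mu>0))) - 1/2 * ln (det C0) + real CARD('m) / 2
          - 1 \<bullet> vec_ln (vec_fact y))" for t
  have g: "C + t *\<^sub>R ?H \<in> spd_matrices \<and> lower_bound A y \<mu>0 C0 x (C + t *\<^sub>R ?H) = g t" if t: "0 \<le> t" "t < 1" for t
  proof -
    have pos: "0 < 1 + t * (d i - 1)" for i
    proof -
      have "0 \<le> t * d i" using t d[of i] by simp
      then show ?thesis using t by (simp add: algebra_simps)
    qed
    have diag: "diag_mat (\<lambda>i. 1 + t * (d i - 1)) = mat 1 + t *\<^sub>R diag_mat (\<lambda>i. d i - 1)"
      by (simp add: diag_mat_one[symmetric] diag_mat_add diag_mat_scaleR)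
    have "?H = P ** diag_mat (\<lambda>i. d i - 1) ** transpose P"
      using diag_congruence_diff[of P d] P(2,3) by simp
    then have eq: "C + t *\<^sub>R ?H = P ** diag_mat (\<lambda>i. 1 + t * (d i - 1)) ** transpose P"
      unfolding diag congruence_add_scaleR by (simp add: P(2))
    have "log_rate A x (C + t *\<^sub>R ?H) i = log_rate A x C i + t * (1/2 * (row i A \<bullet> (?H *v row i A)))" for i
      by (simp add: log_rate_def matrix_vector_mult_add_rdistrib scaleR_matrix_vector_assoc[symmetric]
          inner_add_right distrib_left)
    moreover have "trace (?B ** (C + t *\<^sub>R ?H)) = trace (?B ** C) + t * trace (?B ** ?H)"
    proof -
      have "trace (?B ** (t *\<^sub>R ?H)) = t * trace (?B ** ?H)"
        by (simp add: trace_def matrix_matrix_mult_def sum_distrib_left mult_ac)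
      then show ?thesis by (simp add: matrix_add_ldistrib trace_add)
    qed
    moreover have "ln (det (C + t *\<^sub>R ?H)) = ln (det C) + (\<Sum>i\<in>UNIV. ln (1 + t * (d i - 1)))"
      unfolding eq using ln_det_congruence_diag[OF P(1) pos] by (simp add: P(2))
    ultimately have "lower_bound A y \<mu>0 C0 x (C + t *\<^sub>R ?H) = g t"
      unfolding lower_bound_alt g_def by simp
    moreover have "C + t *\<^sub>R ?H \<in> spd_matrices"
      unfolding eq using spd_congruence_diag_iff[OF P(1)] pos by blast
    ultimately show ?thesis by simp
  qed
  \<comment> \<open>The formula \<open>g\<close> is differentiated on both sides of 0, but it is
    identified with the bound only for \<open>0 \<le> t\<close> and \<open>t < 1\<close>; hence the
    cap at 1 in the choice of \<open>t\<close> below.\<close>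
  have "(g has_real_derivative cov_slope A C0 x C ?H) (at 0)"
    unfolding g_def cov_slope_def tr
    by (auto intro!: derivative_eq_intros simp: algebra_simps)
  with \<open>\<not> ?thesis\<close> obtain e where e: "e > 0" "\<And>t. 0 < t \<Longrightarrow> t < e \<Longrightarrow> g 0 < g (0 + t)"
    using DERIV_pos_inc_right[of g "cov_slope A C0 x C ?H" 0] by (auto simp: not_le)
  define t where "t = min e 1 / 2"
  have t: "0 < t" "t < e" "t < 1" using e(1) by (auto simp: t_def min_def)
  have "g 0 < g t" using e(2)[OF t(1,2)] by simp
  then show False using max[of "C + t *\<^sub>R ?H"] g[of t] g[of 0] t by simp
qed

section \<open>Compactness and convergence\<close>

lemma det_pos_spd: "C \<in> spd_matrices \<Longrightarrow> 0 < det (C :: real^'m^'m)"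
proof -
  assume "C \<in> spd_matrices"
  then obtain L :: "real^'m^'m" where "invertible L" "C = L ** transpose L"
    using spd_factorization by blast
  then show ?thesis by (auto simp: det_mul invertible_det_nz power2_eq_square[symmetric])
qed

lemma continuous_on_lower_bound:
  "continuous_on (UNIV \<times> spd_matrices) (\<lambda>(u, D). lower_bound A y \<mu>0 C0 u D)"
proof -
  have "det (snd p) \<noteq> 0" if "p \<in> UNIV \<times> spd_matrices" for p :: "(real^'a) \<times> (real^'a^'a)"
    using that det_pos_spd[of "snd p"] by auto
  moreover have "continuous_on X (\<lambda>p. det (snd p))" for X :: "((real^'a) \<times> (real^'a^'a)) set"
    unfolding det_def by (intro continuous_intros)
  ultimately show ?thesis
    unfolding lower_bound_alt log_rate_def case_prod_unfold inner_vec_def trace_def matrix_matrix_mult_def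
      matrix_vector_mult_def vec_lambda_beta
    by (intro continuous_intros ballI) simp_all
qed

section \<open>Compactness of superlevel sets\<close>

lemma norm_matrix_le_sum: "norm M \<le> (\<Sum>i\<in>UNIV. \<Sum>j\<in>UNIV. \<bar>M $ i $ j\<bar>)" for M :: "real^'m^'n"
proof -
  have "norm M \<le> (\<Sum>i\<in>UNIV. norm (M $ i))"
    unfolding norm_vec_def[of M] by (rule L2_set_le_sum) simp
  also have "\<dots> \<le> (\<Sum>i\<in>UNIV. \<Sum>j\<in>UNIV. \<bar>M $ i $ j\<bar>)" by (intro sum_mono norm_le_l1_cart)
  finally show ?thesis .
qed

text \<open>Polarisation recovers each entry of a symmetric matrix from three values of its form, so
  bounds on the form bound the matrix. For \<open>0 < a\<close> and positive definite
  \<open>C0\<close> the set stays off the boundary of the cone.\<close>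

lemma compact_spd_order_interval:
  fixes C0 :: "real^'m^'m"
  shows "compact {D. transpose D = D \<and>
    (\<forall>v. a * (v \<bullet> (C0 *v v)) \<le> v \<bullet> (D *v v) \<and> v \<bullet> (D *v v) \<le> b * (v \<bullet> (C0 *v v)))}"
    (is "compact ?M")
proof -
  have "closed ?M"
  proof -
    have "?M = {D. \<forall>i j. D $ i $ j = D $ j $ i} \<inter> {D. \<forall>v. a * (v \<bullet> (C0 *v v)) \<le> v \<bullet> (D *v v)}
        \<inter> {D. \<forall>v. v \<bullet> (D *v v) \<le> b * (v \<bullet> (C0 *v v))}"
      by (auto simp: vec_eq_iff transpose_def)
    also have "closed \<dots>"
      unfolding inner_vec_def matrix_vector_mult_def vec_lambda_beta
      by (intro closed_Int closed_Collect_all closed_Collect_eq closed_Collect_le continuous_intros)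
    finally show ?thesis .
  qed
  moreover have "bounded ?M"
  proof -
    \<comment> \<open>Bounds the absolute value of the form of \<open>D\<close>, whatever the signs
      of the two end points.\<close>
    define q where "q v = \<bar>a * (v \<bullet> (C0 *v v))\<bar> + \<bar>b * (v \<bullet> (C0 *v v))\<bar>" for v
    define e where "e i = (axis i 1 :: real^'m)" for i
    have "norm D \<le> (\<Sum>i\<in>UNIV. \<Sum>j\<in>UNIV. q (e i + e j) + q (e i) + q (e j))" if D: "D \<in> ?M" for D
    proof -
      have q: "\<bar>v \<bullet> (D *v v)\<bar> \<le> q v" for v
      proof -
        have "a * (v \<bullet> (C0 *v v)) \<le> v \<bullet> (D *v v) \<and> v \<bullet> (D *v v) \<le> b * (v \<bullet> (C0 *v v))"
          using D by blast
        then show ?thesis unfolding q_def by linarith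
      qed
      have ent: "e i \<bullet> (D *v e j) = D $ i $ j" for i j
        by (simp add: e_def inner_axis' matrix_vector_mult_basis column_def)
      have "D $ j $ i = D $ i $ j" for i j
        using D by (simp add: vec_eq_iff transpose_def)
      then have "(e i + e j) \<bullet> (D *v (e i + e j)) = e i \<bullet> (D *v e i) + e j \<bullet> (D *v e j) + 2 * D $ i $ j" for i j
        by (simp add: matrix_vector_right_distrib inner_add_left inner_add_right ent)
      then have "\<bar>D $ i $ j\<bar> \<le> q (e i + e j) + q (e i) + q (e j)" for i j
        using q[of "e i + e j"] q[of "e i"] q[of "e j"] by (smt (verit))
      then show ?thesis
        by (intro order_trans[OF norm_matrix_le_sum] sum_mono)
    qed
    then show ?thesis unfolding bounded_iff by blast
  qed
  ultimately show ?thesis by (simp add: compact_eq_bounded_closed)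
qed

text \<open>\<open>d - 1 - ln d\<close> is coercive at both ends: \<open>- ln d\<close> blows up at
  0, and for large \<open>d\<close> the logarithm consumes at most half of \<open>d\<close>.\<close>

lemma bounds_of_diff_ln_le:
  assumes "0 < d" "d - 1 - ln d \<le> \<kappa>"
  shows "exp (- (\<kappa> + 1)) \<le> d" "d \<le> 2 * (\<kappa> + (1::real))"
proof -
  have "- (\<kappa> + 1) \<le> ln d" using assms by linarith
  then have "exp (- (\<kappa> + 1)) \<le> exp (ln d)" by (rule exp_le_cancel_iff[THEN iffD2])
  then show "exp (- (\<kappa> + 1)) \<le> d" using assms by simp
  \<comment> \<open>The two tangent bounds add up to \<open>ln d \<le> d / 2\<close>.\<close>
  have "ln (d / 2) \<le> d / 2 - 1" "ln 2 \<le> 2 - (1::real)"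
    using assms by (intro ln_le_minus_one; simp)+
  then have "ln d \<le> d / 2" using assms by (simp add: ln_div)
  then show "d \<le> 2 * (\<kappa> + 1)" using assms by simp
qed

text \<open>With covariance d relative to the prior in a diagonalising basis, the bound is at most a
  constant minus half of q + sum (d - 1 - ln d), where q is the squared Mahalanobis norm of the mean.\<close>

lemma lower_bound_superlevel_compact:
  fixes C0 :: "real^'m^'m" and A :: "real^'m^'n"
  assumes C0: "C0 \<in> spd_matrices"
  obtains K where "compact K" "K \<subseteq> UNIV \<times> spd_matrices"
    "\<And>u D. D \<in> spd_matrices \<Longrightarrow> c \<le> lower_bound A y \<mu>0 C0 u D \<Longrightarrow> (u, D) \<in> K"
proof -
  obtain L :: "real^'m^'m" where L: "invertible L" "C0 = L ** transpose L"
    using spd_factorization[OF C0] by blast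
  \<comment> \<open>Chosen so that a value of at least \<open>c\<close> means that \<open>?q\<close>
    plus the sum of \<open>d i - 1 - ln (d i)\<close> is at most \<open>\<kappa>\<close>.\<close>
  define \<kappa> where "\<kappa> = 2 * ((\<Sum>i\<in>UNIV. (real (y $ i))\<^sup>2 / 2) - 1 \<bullet> vec_ln (vec_fact y) - c)"
  define a where "a = exp (- (\<kappa> + 1))"
  define b where "b = 2 * (\<kappa> + 1)"
  \<comment> \<open>The ellipsoid on which \<open>?q\<close> is at most
    \<open>\<kappa>\<close>.\<close>
  define X where "X = (\<lambda>z. \<mu>0 + L *v z) ` cball 0 (sqrt \<kappa>)"
  define M where "M = {D. transpose D = D \<and>
    (\<forall>v. a * (v \<bullet> (C0 *v v)) \<le> v \<bullet> (D *v v) \<and> v \<bullet> (D *v v) \<le> b * (v \<bullet> (C0 *v v)))}"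
  show thesis
  proof
    have "compact X" unfolding X_def
      by (intro compact_continuous_image continuous_intros matrix_vector_mult_linear_continuous_on) simp
    then show "compact (X \<times> M)"
      unfolding M_def by (intro compact_Times compact_spd_order_interval)
    have "M \<subseteq> spd_matrices"
    proof
      fix D assume D: "D \<in> M"
      have "0 < v \<bullet> (D *v v)" if "v \<noteq> 0" for v
      proof -
        have "0 < a * (v \<bullet> (C0 *v v))" using C0 that by (simp add: spd_matrices_def a_def)
        also have "\<dots> \<le> v \<bullet> (D *v v)" using D unfolding M_def by blast
        finally show ?thesis .
      qed
      then show "D \<in> spd_matrices" using D by (simp add: M_def spd_matrices_def)
    qed
    then show "X \<times> M \<subseteq> UNIV \<times> spd_matrices" by blast
    fix u D assume D: "D \<in> spd_matrices" and c: "c \<le> lower_bound A y \<mu>0 C0 u D"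
    let ?q = "(u - \<mu>0) \<bullet> (matrix_inv C0 *v (u - \<mu>0))"
    obtain P :: "real^'m^'m" and d where P: "invertible P" "C0 = P ** transpose P"
      "D = P ** diag_mat d ** transpose P" and d: "\<And>i. 0 < d i"
      using spd_simultaneous_diagonalization[OF C0 D] by blast
    have tr: "trace (matrix_inv C0 ** D) = (\<Sum>i\<in>UNIV. d i)"
      using trace_inv_congruence[OF P(1,2)] P(3) by simp
    have ld: "ln (det D) = ln (det C0) + (\<Sum>i\<in>UNIV. ln (d i))"
      using ln_det_congruence_diag[OF P(1) d] P(2,3) by simp
    have "vec_real y \<bullet> (A *v u) - 1 \<bullet> vec_exp (A *v u + (1/2) *\<^sub>R diag_vec (A ** D ** transpose A))
        \<le> (\<Sum>i\<in>UNIV. (real (y $ i))\<^sup>2 / 2)"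
    proof (rule poisson_term_le)
      fix i
      have "0 \<le> row i A \<bullet> (D *v row i A)"
        using D by (cases "row i A = 0") (auto simp: spd_matrices_def less_imp_le)
      then show "(A *v u) $ i \<le> (A *v u + (1/2) *\<^sub>R diag_vec (A ** D ** transpose A)) $ i"
        by (simp add: diag_vec_congruence)
    qed
    moreover have "(\<Sum>i\<in>UNIV. d i - 1 - ln (d i)) = (\<Sum>i\<in>UNIV. d i) - real CARD('m) - (\<Sum>i\<in>UNIV. ln (d i))"
      by (simp add: sum_subtractf)
    ultimately have sum_le: "?q + (\<Sum>i\<in>UNIV. d i - 1 - ln (d i)) \<le> \<kappa>"
      using c unfolding lower_bound_def tr ld \<kappa>_def by argo
    have q_nonneg: "0 \<le> ?q"
      using spd_matrix_inv[OF C0] by (cases "u = \<mu>0") (auto simp: spd_matrices_def less_imp_le)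
    have t_nonneg: "0 \<le> d i - 1 - ln (d i)" for i using ln_le_minus_one[OF d, of i] by simp
    have "d i - 1 - ln (d i) \<le> (\<Sum>i\<in>UNIV. d i - 1 - ln (d i))" for i
      using t_nonneg by (intro member_le_sum) auto
    then have "d i - 1 - ln (d i) \<le> \<kappa>" for i using sum_le q_nonneg by (smt (verit))
    from bounds_of_diff_ln_le[OF d this] have d_bounds: "a \<le> d i" "d i \<le> b" for i
      by (auto simp: a_def b_def)
    have "0 \<le> (\<Sum>i\<in>UNIV. d i - 1 - ln (d i))" by (intro sum_nonneg t_nonneg)
    then have "?q \<le> \<kappa>" using sum_le by linarith
    have "u \<in> X"
    proof -
      obtain H where H: "L ** H = mat 1" using L(1) by (auto simp: invertible_def)
      define z where "z = H *v (u - \<mu>0)"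
      have z: "u - \<mu>0 = L *v z" by (simp add: z_def matrix_vector_mul_assoc H)
      have "?q = z \<bullet> z"
        unfolding z
        by (subst inner_matrix_mult_left)
          (simp only: matrix_vector_mul_assoc matrix_mul_assoc congruence_matrix_inv[OF L] matrix_vector_mul_lid)
      then have "norm z \<le> sqrt \<kappa>" using \<open>?q \<le> \<kappa>\<close> by (simp add: norm_eq_sqrt_inner)
      moreover have "u = \<mu>0 + L *v z" by (simp add: z[symmetric])
      ultimately show ?thesis unfolding X_def by (intro image_eqI[of _ _ z]) auto
    qed
    moreover have "D \<in> M"
    proof -
      have form: "v \<bullet> (D *v v) = (\<Sum>i\<in>UNIV. d i * ((transpose P *v v) $ i)\<^sup>2)" for v
        by (simp add: P(3) inner_congruence inner_diag_mat)
      have form0: "v \<bullet> (C0 *v v) = (\<Sum>i\<in>UNIV. ((transpose P *v v) $ i)\<^sup>2)" for v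
        using inner_congruence[of v P "mat 1"] by (simp add: P(2) inner_vec_def power2_eq_square)
      have "a * (v \<bullet> (C0 *v v)) \<le> v \<bullet> (D *v v) \<and> v \<bullet> (D *v v) \<le> b * (v \<bullet> (C0 *v v))" for v
        unfolding form form0 sum_distrib_left
        by (intro conjI sum_mono mult_right_mono d_bounds) simp_all
      then show ?thesis using D by (simp add: M_def spd_matrices_def)
    qed
    ultimately show "(u, D) \<in> X \<times> M" by blast
  qed
qed

section \<open>Convergence of alternating maximization\<close>

text \<open>Otherwise a subsequence stays a fixed distance from \<open>z\<close>, while compactness
  gives it a further subsequence whose limit must be \<open>z\<close>.\<close>

lemma compact_unique_limit_point_imp_convergent:
  fixes X :: "nat \<Rightarrow> 'a::metric_space"
  assumes K: "compact K" "\<And>n. X n \<in> K"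
    and uniq: "\<And>l r. l \<in> K \<Longrightarrow> strict_mono r \<Longrightarrow> (X \<circ> r) \<longlonglongrightarrow> l \<Longrightarrow> l = z"
  shows "X \<longlonglongrightarrow> z"
proof (rule ccontr)
  assume "\<not> X \<longlonglongrightarrow> z"
  then obtain e where e: "e > 0" and "\<not> eventually (\<lambda>n. dist (X n) z < e) sequentially"
    by (auto simp: tendsto_iff)
  then have "infinite {n. \<not> dist (X n) z < e}"
    by (simp add: cofinite_eq_sequentially[symmetric] eventually_cofinite)
  from infinite_enumerate[OF this]
  obtain r :: "nat \<Rightarrow> nat" where r: "strict_mono r" and far: "\<And>n. \<not> dist (X (r n)) z < e" by auto
  have "\<forall>n. (X \<circ> r) n \<in> K" using K(2) by simp
  with K(1) obtain l s where l: "l \<in> K" and s: "strict_mono s" and lim: "((X \<circ> r) \<circ> s) \<longlonglongrightarrow> l"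
    unfolding compact_eq_seq_compact_metric by (rule seq_compactE)
  have "l = z" using uniq[OF l, of "r \<circ> s"] lim strict_mono_o[OF r s] by (simp add: o_assoc)
  then have "eventually (\<lambda>n. dist (X (r (s n))) z < e) sequentially"
    using lim e by (auto simp: tendsto_iff)
  then show False using far by (auto simp: eventually_sequentially)
qed

text \<open>A limit point of the iterates is maximal in each block separately, hence by hypothesis it is
  the global maximiser. In particular the maximiser exists.\<close>

theorem alternating_maximization_converges:
  fixes G :: "'a::metric_space \<Rightarrow> 'b::metric_space \<Rightarrow> real"
    and x :: "nat \<Rightarrow> 'a" and c :: "nat \<Rightarrow> 'b"
  assumes cont: "continuous_on (UNIV \<times> S) (\<lambda>(u, d). G u d)"
    and K: "compact K" "K \<subseteq> UNIV \<times> S"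
    and superlevel: "\<And>u d. d \<in> S \<Longrightarrow> G (x 0) (c 0) \<le> G u d \<Longrightarrow> (u, d) \<in> K"
    and stationary: "\<And>u d u' d'. d \<in> S \<Longrightarrow> (\<And>v. G v d \<le> G u d) \<Longrightarrow> (\<And>e. e \<in> S \<Longrightarrow> G u e \<le> G u d)
      \<Longrightarrow> d' \<in> S \<Longrightarrow> (u', d') \<noteq> (u, d) \<Longrightarrow> G u' d' < G u d"
    and c0: "c 0 \<in> S"
    and x_max: "\<And>k v. G v (c k) \<le> G (x (Suc k)) (c k)"
    and c_max: "\<And>k e. e \<in> S \<Longrightarrow> G (x (Suc k)) e \<le> G (x (Suc k)) (c (Suc k))"
    and cS: "\<And>k. c (Suc k) \<in> S"
    and x_unique: "\<And>k v. v \<noteq> x (Suc k) \<Longrightarrow> G v (c k) < G (x (Suc k)) (c k)"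
    and c_unique: "\<And>k e. e \<in> S \<Longrightarrow> e \<noteq> c (Suc k) \<Longrightarrow> G (x (Suc k)) e < G (x (Suc k)) (c (Suc k))"
  obtains z where "snd z \<in> S" "\<And>u d. d \<in> S \<Longrightarrow> (u, d) \<noteq> z \<Longrightarrow> G u d < G (fst z) (snd z)"
    "\<And>k. (x k, c k) \<noteq> z \<Longrightarrow> G (x k) (c k) < G (x (Suc k)) (c (Suc k))"
    "\<And>k. (x k, c k) \<noteq> z \<Longrightarrow> (k = 0 \<Longrightarrow> x 1 \<noteq> x 0) \<Longrightarrow> G (x k) (c k) < G (x (Suc k)) (c k)"
    "\<And>k. (x (Suc k), c k) \<noteq> z \<Longrightarrow> G (x (Suc k)) (c k) < G (x (Suc k)) (c (Suc k))"
    "convergent (\<lambda>k. G (x k) (c k))"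
    "(\<lambda>k. (x k, c k)) \<longlonglongrightarrow> z"
proof -
  have S: "c k \<in> S" for k using c0 cS by (cases k) auto
  define f where "f k = G (x k) (c k)" for k
  have f_Suc: "f k \<le> f (Suc k)" for k
    unfolding f_def using x_max[of "x k" k] c_max[OF S[of k], of k] by linarith
  then have inc: "incseq f" by (rule incseq_SucI)
  \<comment> \<open>The values increase, so the iterates never leave the superlevel set of the
    starting point.\<close>
  have inK: "(x k, c k) \<in> K" for k
    using superlevel[OF S, of "x k" k] incseqD[OF inc, of 0 k] by (simp add: f_def)
  have "compact ((\<lambda>(u, d). G u d) ` K)"
    using cont K by (intro compact_continuous_image) (auto intro: continuous_on_subset)
  then obtain B where B: "\<And>k. f k \<le> B"
  proof -
    assume *: "\<And>B. (\<And>k. f k \<le> B) \<Longrightarrow> thesis"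
    obtain B where B: "\<And>t. t \<in> (\<lambda>(u, d). G u d) ` K \<Longrightarrow> \<bar>t\<bar> \<le> B"
      using \<open>compact ((\<lambda>(u, d). G u d) ` K)\<close> compact_imp_bounded bounded_real by metis
    have "f k \<le> B" for k
      using B[OF imageI[OF inK[of k]]] by (simp add: f_def)
    then show thesis by (rule *)
  qed
  obtain L where L: "f \<longlonglongrightarrow> L" "\<And>k. f k \<le> L"
    using incseq_convergent[OF inc] B by (metis)
  have lim: "(\<lambda>n. G (p n) (q n)) \<longlonglongrightarrow> G u d"
    if "p \<longlonglongrightarrow> u" "q \<longlonglongrightarrow> d" "d \<in> S" "\<And>n. q n \<in> S" for p q u d
  proof -
    have "(\<lambda>n. (\<lambda>(u, d). G u d) (p n, q n)) \<longlonglongrightarrow> (\<lambda>(u, d). G u d) (u, d)"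
      using that by (intro continuous_on_tendsto_compose[OF cont]) (auto intro: tendsto_Pair)
    then show ?thesis by simp
  qed
  have limit_point: "d \<in> S \<and> (\<forall>v. G v d \<le> G u d) \<and> (\<forall>e\<in>S. G u e \<le> G u d)"
    if uK: "(u, d) \<in> K" and r: "strict_mono r" and conv: "((\<lambda>k. (x k, c k)) \<circ> r) \<longlonglongrightarrow> (u, d)" for u d r
  proof -
    have xr: "(\<lambda>n. x (r n)) \<longlonglongrightarrow> u" and cr: "(\<lambda>n. c (r n)) \<longlonglongrightarrow> d"
      using tendsto_fst[OF conv] tendsto_snd[OF conv] by (simp_all add: o_def)
    have dS: "d \<in> S" using uK K by auto
    have "(\<lambda>n. f (r n)) \<longlonglongrightarrow> G u d" unfolding f_def using lim[OF xr cr dS S] .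
    moreover have "(\<lambda>n. f (r n)) \<longlonglongrightarrow> L" using LIMSEQ_subseq_LIMSEQ[OF L(1) r] by (simp add: o_def)
    ultimately have GL: "G u d = L" by (rule LIMSEQ_unique)
    \<comment> \<open>\<open>c k\<close> is matched with \<open>x (Suc k)\<close>, not with
      \<open>x k\<close>; the index shift is harmless because every value of \<open>f\<close> is
      below the common limit \<open>L\<close>.\<close>
    have "G v d \<le> L" for v
    proof (rule LIMSEQ_le_const2)
      show "(\<lambda>n. G v (c (r n))) \<longlonglongrightarrow> G v d" using lim[OF tendsto_const cr dS S] .
      have "G v (c k) \<le> L" for k
        using x_max[of v k] c_max[OF S[of k], of k] L(2)[of "Suc k"] by (simp add: f_def)
      then show "\<exists>N. \<forall>n\<ge>N. G v (c (r n)) \<le> L" by blast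
    qed
    moreover have "G u e \<le> L" if "e \<in> S" for e
    proof (rule LIMSEQ_le_const2)
      show "(\<lambda>n. G (x (r n)) e) \<longlonglongrightarrow> G u e" using lim[OF xr tendsto_const that] that by simp
      \<comment> \<open>Index 0 is excluded: only from 1 on is \<open>c k\<close> the best response
        to \<open>x k\<close>.\<close>
      have "G (x (r n)) e \<le> L" if "n \<ge> 1" for n
      proof -
        have "r n \<ge> 1" using seq_suble[OF r, of n] that by simp
        then obtain j where "r n = Suc j" by (cases "r n") auto
        then show ?thesis using c_max[OF \<open>e \<in> S\<close>, of j] L(2)[of "Suc j"] by (simp add: f_def)
      qed
      then show "\<exists>N. \<forall>n\<ge>N. G (x (r n)) e \<le> L" by blast
    qed
    ultimately show ?thesis using dS GL by simp
  qed
  have "\<forall>k. (x k, c k) \<in> K" using inK by simp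
  with K(1) obtain z r where z: "z \<in> K" "strict_mono r" "((\<lambda>k. (x k, c k)) \<circ> r) \<longlonglongrightarrow> z"
    unfolding compact_eq_seq_compact_metric by (rule seq_compactE)
  have zS: "snd z \<in> S" using z(1) K by auto
  have z_max: "G u d < G (fst z) (snd z)" if "d \<in> S" "(u, d) \<noteq> z" for u d
    using limit_point[of "fst z" "snd z" r] z stationary[of "snd z" "fst z" d u] that by simp
  \<comment> \<open>Two distinct blockwise maximal points would each lie strictly above the
    other.\<close>
  have z_unique: "(u, d) = z"
    if "d \<in> S" "\<And>v. G v d \<le> G u d" "\<And>e. e \<in> S \<Longrightarrow> G u e \<le> G u d" for u d
  proof (rule ccontr)
    assume ne: "(u, d) \<noteq> z"
    then have "(fst z, snd z) \<noteq> (u, d)" by auto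
    from stationary[OF that zS this] z_max[OF that(1) ne] show False by simp
  qed
  show thesis
  proof
    show "snd z \<in> S" by fact
    show "\<And>u d. d \<in> S \<Longrightarrow> (u, d) \<noteq> z \<Longrightarrow> G u d < G (fst z) (snd z)" by fact
    show mid: "G (x (Suc k)) (c k) < G (x (Suc k)) (c (Suc k))" if "(x (Suc k), c k) \<noteq> z" for k
    proof (rule ccontr)
      assume "\<not> ?thesis"
      then have "c k = c (Suc k)" using c_unique[OF S[of k], of k] by auto
      \<comment> \<open>An unchanged \<open>c k\<close> is also the best response to
        \<open>x (Suc k)\<close>, so the pair is maximal in both blocks.\<close>
      then have "(x (Suc k), c k) = z" using z_unique[OF S x_max[of _ k]] c_max[of _ k] by metis
      then show False using that by simp
    qed
    show "G (x k) (c k) < G (x (Suc k)) (c (Suc k))" if "(x k, c k) \<noteq> z" for k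
    proof (cases "x k = x (Suc k)")
      case True
      then show ?thesis using mid[of k] that by simp
    next
      case False
      then show ?thesis using x_unique[OF False] c_max[OF S[of k], of k] by simp
    qed
    show "G (x k) (c k) < G (x (Suc k)) (c k)" if ne: "(x k, c k) \<noteq> z" "k = 0 \<Longrightarrow> x 1 \<noteq> x 0" for k
    proof (rule x_unique, rule notI)
      \<comment> \<open>For a successor index \<open>c k\<close> already answers \<open>x k\<close>,
        so an unchanged mean makes the pair maximal in both blocks. The argument breaks at 0, where
        \<open>c 0\<close> is arbitrary.\<close>
      assume eq: "x k = x (Suc k)"
      then obtain j where j: "k = Suc j" using ne(2) by (cases k) auto
      have "(x k, c k) = z"
        using z_unique[OF S[of k], of "x k"] x_max[of _ k] c_max[of _ j] eq j by metis
      then show False using ne(1) by simp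
    qed
    show "convergent (\<lambda>k. G (x k) (c k))" using L(1) unfolding convergent_def f_def[abs_def] by blast
    show "(\<lambda>k. (x k, c k)) \<longlonglongrightarrow> z"
    proof (rule compact_unique_limit_point_imp_convergent[OF K(1) inK])
      fix l r assume "l \<in> K" "strict_mono r" "((\<lambda>k. (x k, c k)) \<circ> r) \<longlonglongrightarrow> l"
      then show "l = z" using limit_point[of "fst l" "snd l" r] z_unique[of "snd l" "fst l"] by simp
    qed
  qed
qed

text \<open>Convergence is reached when the current pair equals \<open>z\<close>. Every sweep and
  every half-step that starts elsewhere is strict, with one exception: \<open>x 0\<close> may
  already be the best mean for \<open>C 0\<close> without the pair being optimal. Then
  \<open>x 1 = x 0\<close> and the first half-step is an equality, hence the side condition at
  \<open>k = 0\<close>.\<close>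

theorem mainTheorem6:
  fixes A :: "real^'m^'n" and y :: "nat^'n" and \<mu>0 :: "real^'m" and C0 :: "real^'m^'m"
    and x :: "nat \<Rightarrow> real^'m" and C :: "nat \<Rightarrow> real^'m^'m"
    and F :: "real^'m \<Rightarrow> real^'m^'m \<Rightarrow> real"
  defines "F \<equiv> lower_bound A y \<mu>0 C0"
  assumes "C0 \<in> spd_matrices"
    and "C 0 \<in> spd_matrices"
    and "\<And>k. is_arg_max (\<lambda>u. F u (C k)) (\<lambda>u. u \<in> UNIV) (x (Suc k))"
    and "\<And>k. is_arg_max (\<lambda>D. F (x (Suc k)) D) (\<lambda>D. D \<in> spd_matrices) (C (Suc k))"
  shows "\<exists>z.
    is_arg_max (\<lambda>(u, D). F u D) (\<lambda>w. w \<in> UNIV \<times> spd_matrices) z \<and>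
    (\<forall>z'. is_arg_max (\<lambda>(u, D). F u D) (\<lambda>w. w \<in> UNIV \<times> spd_matrices) z' \<longrightarrow> z' = z) \<and>
    (\<forall>k. F (x k) (C k) \<le> F (x (Suc k)) (C k) \<and>
         F (x (Suc k)) (C k) \<le> F (x (Suc k)) (C (Suc k))) \<and>
    (\<forall>k. (x k, C k) \<noteq> z \<longrightarrow> F (x k) (C k) < F (x (Suc k)) (C (Suc k))) \<and>
    (\<forall>k. (x k, C k) \<noteq> z \<and> (k = 0 \<longrightarrow> x 1 \<noteq> x 0) \<longrightarrow>
         F (x k) (C k) < F (x (Suc k)) (C k)) \<and>
    (\<forall>k. (x (Suc k), C k) \<noteq> z \<longrightarrow> F (x (Suc k)) (C k) < F (x (Suc k)) (C (Suc k))) \<and>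
    (\<forall>k. F (x k) (C k) \<le> ln (evidence A \<mu>0 C0 y)) \<and>
    convergent (\<lambda>k. F (x k) (C k)) \<and>
    (\<lambda>k. (x k, C k)) \<longlonglongrightarrow> z"
proof -
  note C0 = assms(2)
  have x_max: "F v (C k) \<le> F (x (Suc k)) (C k)" for k v
    using assms(4)[of k] by (simp add: is_arg_max_linorder)
  have c_max: "F (x (Suc k)) D \<le> F (x (Suc k)) (C (Suc k))" if "D \<in> spd_matrices" for k D
    using assms(5)[of k] that by (simp add: is_arg_max_linorder)
  have cS: "C (Suc k) \<in> spd_matrices" for k
    using assms(5)[of k] by (simp add: is_arg_max_linorder)
  have S: "C k \<in> spd_matrices" for k using assms(3) cS by (cases k) auto
  have super: "F u D < F v E + mean_slope A y \<mu>0 C0 v E (u - v) + cov_slope A C0 v E (D - E)"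
    if "E \<in> spd_matrices" "D \<in> spd_matrices" "(u, D) \<noteq> (v, E)" for u v D E
    unfolding F_def using lower_bound_supergradient[OF C0 that] .
  have mean: "mean_slope A y \<mu>0 C0 v E h \<le> 0" if "\<And>u. F u E \<le> F v E" for v E h
    using mean_slope_nonpos[OF _ C0] that unfolding F_def by blast
  have cov: "cov_slope A C0 v E (D - E) \<le> 0"
    if "\<And>H. H \<in> spd_matrices \<Longrightarrow> F v H \<le> F v E" "E \<in> spd_matrices" "D \<in> spd_matrices" for v D E
    using cov_slope_nonpos[OF _ that(2,3)] that(1) unfolding F_def by blast
  have zero: "mean_slope A y \<mu>0 C0 v E 0 = 0" "cov_slope A C0 v E 0 = 0" for v E
    by (simp_all add: mean_slope_def cov_slope_def trace_def matrix_matrix_mult_def)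
  have stationary: "F u' d' < F u d"
    if "d \<in> spd_matrices" "\<And>v. F v d \<le> F u d" "\<And>e. e \<in> spd_matrices \<Longrightarrow> F u e \<le> F u d"
      "d' \<in> spd_matrices" "(u', d') \<noteq> (u, d)" for u d u' d'
    using super[OF that(1,4,5)] mean[OF that(2), of "u' - u"] cov[OF that(3,1,4)] by simp
  \<comment> \<open>\<open>is_arg_max\<close> only says that no value is larger. Uniqueness follows
    from the strict supergradient inequality with the covariance held fixed, where its slope is
    taken in direction 0 and vanishes.\<close>
  have x_unique: "F v (C k) < F (x (Suc k)) (C k)" if "v \<noteq> x (Suc k)" for k v
    using super[OF S S, of v k "x (Suc k)" k] mean[OF x_max, of k] that by (simp add: zero) (smt (verit))
  have c_unique: "F (x (Suc k)) e < F (x (Suc k)) (C (Suc k))" if "e \<in> spd_matrices" "e \<noteq> C (Suc k)" for k e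
    using super[OF cS that(1), of "x (Suc k)" "x (Suc k)" k] cov[OF c_max cS that(1), of k] that(2)
    by (simp add: zero)
  obtain K where K: "compact K" "K \<subseteq> UNIV \<times> spd_matrices"
    "\<And>u D. D \<in> spd_matrices \<Longrightarrow> F (x 0) (C 0) \<le> F u D \<Longrightarrow> (u, D) \<in> K"
    using lower_bound_superlevel_compact[OF C0] unfolding F_def by metis
  have cont: "continuous_on (UNIV \<times> spd_matrices) (\<lambda>(u, D). F u D)"
    unfolding F_def by (rule continuous_on_lower_bound)
  obtain z where z: "snd z \<in> spd_matrices"
      "\<And>u d. d \<in> spd_matrices \<Longrightarrow> (u, d) \<noteq> z \<Longrightarrow> F u d < F (fst z) (snd z)"
    and conv: "\<And>k. (x k, C k) \<noteq> z \<Longrightarrow> F (x k) (C k) < F (x (Suc k)) (C (Suc k))"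
    "\<And>k. (x k, C k) \<noteq> z \<Longrightarrow> (k = 0 \<Longrightarrow> x 1 \<noteq> x 0) \<Longrightarrow> F (x k) (C k) < F (x (Suc k)) (C k)"
    "\<And>k. (x (Suc k), C k) \<noteq> z \<Longrightarrow> F (x (Suc k)) (C k) < F (x (Suc k)) (C (Suc k))"
    "convergent (\<lambda>k. F (x k) (C k))" "(\<lambda>k. (x k, C k)) \<longlonglongrightarrow> z"
    by (rule alternating_maximization_converges[OF cont K stationary assms(3) x_max c_max cS x_unique c_unique]) blast+
  have "is_arg_max (\<lambda>(u, D). F u D) (\<lambda>w. w \<in> UNIV \<times> spd_matrices) z"
  proof -
    have "F (fst w) (snd w) \<le> F (fst z) (snd z)" if "w \<in> UNIV \<times> spd_matrices" for w
      using z(2)[of "snd w" "fst w"] that by (cases "w = z") auto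
    then show ?thesis
      using z(1) by (simp add: is_arg_max_linorder case_prod_unfold mem_Times_iff)
  qed
  moreover have "z' = z" if "is_arg_max (\<lambda>(u, D). F u D) (\<lambda>w. w \<in> UNIV \<times> spd_matrices) z'" for z'
  proof (rule ccontr)
    assume "z' \<noteq> z"
    then have "F (fst z') (snd z') < F (fst z) (snd z)"
      using that z(2)[of "snd z'" "fst z'"] by (auto simp: is_arg_max_linorder)
    then show False using that z(1) unfolding is_arg_max_linorder by (auto simp: case_prod_unfold not_le[symmetric])
  qed
  moreover have "F (x k) (C k) \<le> ln (evidence A \<mu>0 C0 y)" for k
    unfolding F_def by (rule lower_bound_le_ln_evidence[OF C0 S])
  ultimately show ?thesis
    using x_max c_max[OF S] conv by (intro exI[of _ z]) blast
qed

end
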